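(* Let $d\ge 2$ be an integer and let $B$ be the unit ball in $\mathbb{R}^d$. Then $$\lim_{t\to 0+}\frac{1}{t}\left(|B|-\mathbb{H}_B(t)-\frac{|\mathbb{S}^{d-1}|}{\pi}\,t\ln\left(\frac1t\right)\right)=|\mathbb{S}^{d-1}|\left(\kappa_d\left\{\frac{|B|}{2}-\int_0^1 s^{-1}\gamma_B(2s)\,ds\right\}+\frac1\pi\left\{2\ln(2)+\int_0^\infty\left(\tanh^d(\theta)-1\right)d\theta\right\}\right).$$
   Context: $|x|$ denotes the Euclidean norm of $x\in\mathbb{R}^d$. $B=\{x\in\mathbb{R}^d:|x|<1\}$ is the unit ball centered at the origin (open or closed is immaterial, since only Lebesgue measure enters), $|B|$ is its volume, and $|\mathbb{S}^{d-1}|$ is the surface area of its boundary $\mathbb{S}^{d-1}$. For integers $1\le k\le d$, $w_k=\pi^{k/2}/\Gamma(1+k/2)$ is the volume of the unit ball in $\mathbb{R}^k$ (so $|B|=w_d$ and $|\mathbb{S}^{d-1}|=d\,w_d$). Let $e_d=(0,\dots,0,1)\in\mathbb{R}^d$. Constant: $\kappa_d=\Gamma\left(\frac{d+1}{2}\right)\pi^{-\frac{d+1}{2}}$. Poisson heat kernel: $p_t(x)=\dfrac{\kappa_d\,t}{(t^2+|x|^2)^{(d+1)/2}}$ for $x\in\mathbb{R}^d$, $t>0$. Heat content over the unit ball: $\mathbb{H}_B(t)=\int_B\int_B p_t(x-y)\,dy\,dx$. Set covariance function of $B$: $g_B(z)=|B\cap(B+z)|$ (Lebesgue measure), $z\in\mathbb{R}^d$.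 For $s>0$: $\gamma_B(s)=w_{d-1}-\dfrac{g_B(0)-g_B(s e_d)}{s}$. *)

theory Defs
  imports "HOL-Analysis.Analysis"
begin

text \<open>
  The surface area of a compact hypersurface \<open>A\<close> in its ambient space is defined as its
  Minkowski content of codimension one: the rate at which the volume of the (two-sided)
  \<open>\<epsilon>\<close>-neighbourhood grows.  For the unit sphere it is \<open>d w\<^sub>d\<close>, see
  \<open>surface_area_unit_sphere\<close> below.
\<close>
definition surface_area :: "'a::euclidean_space set \<Rightarrow> real" where
  "surface_area A =
     Lim (at_right 0) (\<lambda>\<epsilon>. measure lborel (\<Union>y\<in>A. ball y \<epsilon>) / (2 * \<epsilon>))"

definition kappa :: "nat \<Rightarrow> real" where
  "kappa d = Gamma ((real d + 1) / 2) * pi powr (- ((real d + 1) / 2))"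

definition poisson_kernel :: "real \<Rightarrow> real ^ 'n \<Rightarrow> real" where
  "poisson_kernel t x =
     kappa CARD('n) * t / (t\<^sup>2 + (norm x)\<^sup>2) powr ((real CARD('n) + 1) / 2)"

definition heat_content :: "(real ^ 'n) set \<Rightarrow> real \<Rightarrow> real" where
  "heat_content A t =
     set_lebesgue_integral lborel A
       (\<lambda>x. set_lebesgue_integral lborel A (\<lambda>y. poisson_kernel t (x - y)))"

definition set_covariance :: "'a::euclidean_space set \<Rightarrow> 'a \<Rightarrow> real" where
  "set_covariance A z = measure lborel (A \<inter> (\<lambda>x. x + z) ` A)"

text \<open>
  Here \<open>e\<close> is the unit vector along which the unit ball is translated.  The library's
  \<open>unit_ball_vol (real k)\<close> is \<open>w\<^sub>k\<close>.
\<close>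
definition gamma_ball :: "real ^ 'n \<Rightarrow> real \<Rightarrow> real" where
  "gamma_ball e s =
     unit_ball_vol (real (CARD('n) - 1))
       - (set_covariance (ball 0 1) (0 :: real ^ 'n) - set_covariance (ball 0 1) (s *\<^sub>R e)) / s"

lemma unit_sphere_neighbourhood:
  assumes "0 < \<epsilon>" "\<epsilon> < 1"
  shows "(\<Union>y\<in>sphere (0::'a::euclidean_space) 1. ball y \<epsilon>) = ball 0 (1 + \<epsilon>) - cball 0 (1 - \<epsilon>)"
proof (intro equalityI subsetI)
  fix x :: 'a assume "x \<in> (\<Union>y\<in>sphere 0 1. ball y \<epsilon>)"
  then obtain y where y: "norm y = 1" "norm (y - x) < \<epsilon>"
    by (auto simp: dist_norm)
  have "norm x \<le> norm y + norm (y - x)" "norm y \<le> norm x + norm (y - x)"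
    using norm_triangle_ineq4[of y "y - x"] norm_triangle_ineq[of x "y - x"] by simp_all
  with y show "x \<in> ball 0 (1 + \<epsilon>) - cball 0 (1 - \<epsilon>)" by simp
next
  fix x :: 'a assume "x \<in> ball 0 (1 + \<epsilon>) - cball 0 (1 - \<epsilon>)"
  then have x: "norm x < 1 + \<epsilon>" "norm x > 1 - \<epsilon>" by auto
  with assms have nz: "norm x > 0" by linarith
  have "x /\<^sub>R norm x - x = (1 / norm x - 1) *\<^sub>R x"
    by (simp add: algebra_simps inverse_eq_divide)
  then have "norm (x /\<^sub>R norm x - x) = \<bar>1 / norm x - 1\<bar> * \<bar>norm x\<bar>"
    by simp
  also have "\<dots> = \<bar>1 - norm x\<bar>"
    using nz by (simp only: abs_mult[symmetric]) (simp add: algebra_simps)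
  also have "\<dots> < \<epsilon>" using x by linarith
  finally show "x \<in> (\<Union>y\<in>sphere 0 1. ball y \<epsilon>)"
    using nz by (intro UN_I[of "x /\<^sub>R norm x"]) (auto simp: dist_norm)
qed

lemma surface_area_unit_sphere:
  "surface_area (sphere (0::'a::euclidean_space) 1) = real DIM('a) * unit_ball_vol (real DIM('a))"
proof -
  define d where "d = DIM('a)"
  define w where "w = unit_ball_vol (real d)"
  have meas: "measure lborel (\<Union>y\<in>sphere (0::'a) 1. ball y \<epsilon>) = w * ((1 + \<epsilon>) ^ d - (1 - \<epsilon>) ^ d)"
    if "0 < \<epsilon>" "\<epsilon> < 1" for \<epsilon>
  proof -
    have "measure lborel (ball (0::'a) (1 + \<epsilon>) - cball 0 (1 - \<epsilon>))
        = measure lborel (ball (0::'a) (1 + \<epsilon>)) - measure lborel (cball (0::'a) (1 - \<epsilon>))"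
      using that by (intro measure_Diff) (auto simp: emeasure_ball emeasure_lborel_ball_finite)
    then show ?thesis
      using that by (simp add: unit_sphere_neighbourhood content_ball content_cball
          d_def w_def algebra_simps)
  qed
  have "((\<lambda>\<epsilon>::real. (1 + \<epsilon>) ^ d - (1 - \<epsilon>) ^ d) has_real_derivative 2 * real d) (at 0)"
    by (auto intro!: derivative_eq_intros)
  then have "((\<lambda>\<epsilon>::real. ((1 + \<epsilon>) ^ d - (1 - \<epsilon>) ^ d) / \<epsilon>) \<longlongrightarrow> 2 * real d) (at_right 0)"
    by (auto simp: has_field_derivative_iff intro: filterlim_mono[OF _ order_refl at_le])
  then have "((\<lambda>\<epsilon>::real. w / 2 * (((1 + \<epsilon>) ^ d - (1 - \<epsilon>) ^ d) / \<epsilon>)) \<longlongrightarrow> w / 2 * (2 * real d))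
      (at_right 0)"
    by (rule tendsto_mult_left)
  moreover have "\<forall>\<^sub>F \<epsilon> in at_right (0::real). 0 < \<epsilon> \<and> \<epsilon> < 1"
    by (auto simp: eventually_at_right_field intro: exI[of _ 1])
  then have "\<forall>\<^sub>F \<epsilon> in at_right 0. w / 2 * (((1 + \<epsilon>) ^ d - (1 - \<epsilon>) ^ d) / \<epsilon>)
      = measure lborel (\<Union>y\<in>sphere (0::'a) 1. ball y \<epsilon>) / (2 * \<epsilon>)"
    by eventually_elim (simp add: meas)
  ultimately have "((\<lambda>\<epsilon>. measure lborel (\<Union>y\<in>sphere (0::'a) 1. ball y \<epsilon>) / (2 * \<epsilon>))
      \<longlongrightarrow> w / 2 * (2 * real d)) (at_right 0)"
    by (rule Lim_transform_eventually)
  then show ?thesis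
    unfolding surface_area_def by (subst tendsto_Lim) (auto simp: d_def w_def mult.commute)
qed

end

theory Submission
  imports Defs "HOL-Real_Asymp.Real_Asymp"
begin

text \<open>
  Let \<open>B\<close> be the unit ball, \<open>g\<close> its covariance function and \<open>\<phi>(r) = |B| - g(r e)\<close> for a unit vector
  \<open>e\<close>.  By Tonelli's theorem the heat content is \<open>\<integral> p\<^sub>t(z) g(z) dz\<close>, and the Poisson kernel has
  total mass one, so the heat loss \<open>|B| - H(t)\<close> is \<open>\<integral> p\<^sub>t(z) (|B| - g(z)) dz\<close>.  Because \<open>g\<close> is
  rotation invariant (\<open>set_covariance_orthogonal\<close>), polar coordinates reduce this to a
  one-dimensional integral (\<open>heat_loss_radial\<close>):
  \<open>(|B| - H(t)) / t = |S| \<kappa>\<^sub>d \<integral>\<^sub>0\<^sup>\<infinity> r\<^sup>d\<^sup>-\<^sup>1 \<phi>(r) / sqrt (t\<^sup>2 + r\<^sup>2)\<^sup>d\<^sup>+\<^sup>1 dr\<close>.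

  At \<open>t = 0\<close> the integrand would be \<open>\<phi>(r) / r\<^sup>2\<close>, and how this diverges is decided by the behaviour
  of \<open>\<phi>\<close> at the origin.  Geometrically, \<open>\<phi>(r)\<close> is the volume of the slab of width \<open>r\<close> around the
  equator of \<open>B\<close> (\<open>ball_covariance_drop_eq_slab\<close>); comparing the slab with cylinders gives
  \<open>\<phi>(r) = w\<^sub>d\<^sub>-\<^sub>1 r + O(r\<^sup>3)\<close>, while \<open>\<phi>(r) = |B|\<close> for \<open>r \<ge> 2\<close>.

  Hence only the linear part of \<open>\<phi>\<close> on \<open>(0, 2)\<close> is singular.  The substitution \<open>r = t sinh \<theta>\<close>
  turns its contribution into the integral of \<open>tanh\<^sup>d\<close> over \<open>(0, arsinh (2 / t))\<close>, which is
  \<open>ln (1 / t) + 2 ln 2\<close> plus the convergent integral of \<open>tanh\<^sup>d - 1\<close>, up to \<open>o(1)\<close>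
  (\<open>tendsto_radial_main_term\<close>).  The rest of \<open>\<phi>\<close> is handled by dominated convergence
  (\<open>tendsto_radial_remainder\<close>): the part beyond \<open>2\<close> contributes \<open>|B| / 2\<close>, and the part below
  \<open>2\<close> contributes minus the integral of \<open>\<gamma>\<^sub>B(r) / r\<close>.  The identity \<open>\<kappa>\<^sub>d w\<^sub>d\<^sub>-\<^sub>1 = 1 / \<pi>\<close> puts the constants
  into the stated form.
\<close>

section \<open>Lebesgue measure: isometries, polar coordinates, cylinders\<close>

text \<open>
  The image \<open>N\<close> of Lebesgue measure under a linear bijection is again translation invariant, and
  an isometry preserves the volume of the unit ball.  So it suffices that a translation invariant
  measure is determined up to a factor, and this follows from Tonelli's theorem: integrating
  \<open>1\<^sub>A(x) 1\<^sub>E(x + y)\<close> against \<open>N(dx) dy\<close> in either order gives \<open>N(A) |E| = |-A| N(E)\<close>, and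
  \<open>E\<close> is taken to be the unit ball.
\<close>
lemma lborel_distr_orthogonal:
  fixes f :: "'a::euclidean_space \<Rightarrow> 'a"
  assumes f: "orthogonal_transformation f"
  shows "distr lborel borel f = lborel"
proof -
  define N where "N = distr lborel borel f"
  have lin: "linear f" and nf: "\<And>x. norm (f x) = norm x"
    using f by (auto simp: orthogonal_transformation_linear orthogonal_transformation_norm)
  have fm [measurable]: "f \<in> borel_measurable borel"
    using lin by (intro borel_measurable_continuous_onI linear_continuous_on)
      (simp add: linear_conv_bounded_linear)
  have setsN [measurable_cong]: "sets N = sets borel"
    by (simp add: N_def)
  have emN: "emeasure N A = emeasure lborel (f -` A)" if "A \<in> sets borel" for A
    using that by (simp add: N_def emeasure_distr)
  have ballN: "emeasure N (ball 0 r) = emeasure lborel (ball (0::'a) r)" for r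
  proof -
    have "f -` ball 0 r = ball 0 r"
      by (auto simp: nf)
    then show ?thesis by (simp add: emN)
  qed
  interpret N: sigma_finite_measure N
  proof
    show "\<exists>A. countable A \<and> A \<subseteq> sets N \<and> \<Union> A = space N \<and> (\<forall>a\<in>A. emeasure N a \<noteq> \<infinity>)"
      by (rule exI[of _ "range (\<lambda>n::nat. ball 0 (real n))"])
        (use emeasure_lborel_ball_finite[of "0::'a"] in
          \<open>auto simp: setsN ballN less_top[symmetric] sets_eq_imp_space_eq[OF setsN] reals_Archimedean2\<close>)
  qed
  have transN: "distr N borel ((+) c) = N" for c
  proof -
    obtain a where a: "f a = c"
      using orthogonal_transformation_surj[OF f] by (metis surjD)
    have "distr N borel ((+) c) = distr lborel borel (\<lambda>x. f (a + x))"
      unfolding N_def by (subst distr_distr) (auto simp: o_def linear_add[OF lin] a)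
    also have "\<dots> = distr (distr lborel borel ((+) a)) borel f"
      by (subst distr_distr) (auto simp: o_def)
    finally show ?thesis
      by (simp add: lborel_distr_plus N_def)
  qed
  interpret P: pair_sigma_finite N "lborel :: 'a measure" ..
  have eq: "emeasure N A * emeasure lborel E = emeasure lborel (uminus -` A) * emeasure N E"
    if [measurable]: "A \<in> sets borel" "E \<in> sets borel" for A E :: "'a set"
  proof -
    have "emeasure N A * emeasure lborel E
        = (\<integral>\<^sup>+x. \<integral>\<^sup>+y. indicator A x * indicator E (x + y) \<partial>lborel \<partial>N)"
    proof -
      have "(\<integral>\<^sup>+y. indicator A x * indicator E (x + y) \<partial>lborel) = emeasure lborel E * indicator A x" for x
      proof -
        have "(\<integral>\<^sup>+y. indicator A x * indicator E (x + y) \<partial>lborel)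
            = indicator A x * (\<integral>\<^sup>+y. indicator E y \<partial>distr lborel borel ((+) x))"
          by (subst nn_integral_cmult, simp, subst nn_integral_distr, auto)
        then show ?thesis by (simp add: lborel_distr_plus mult.commute)
      qed
      then have "(\<integral>\<^sup>+x. \<integral>\<^sup>+y. indicator A x * indicator E (x + y) \<partial>lborel \<partial>N)
          = (\<integral>\<^sup>+x. emeasure lborel E * indicator A x \<partial>N)"
        by (rule nn_integral_cong)
      also have "\<dots> = emeasure lborel E * emeasure N A"
        by (rule nn_integral_cmult_indicator) (simp add: setsN)
      finally show ?thesis
        by (simp add: mult.commute)
    qed
    also have "\<dots> = (\<integral>\<^sup>+y. \<integral>\<^sup>+x. indicator A x * indicator E (x + y) \<partial>N \<partial>lborel)"
      by (rule P.Fubini'[symmetric]) measurable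
    \<comment> \<open>Translation invariance of \<open>N\<close> replaces \<open>x\<close> by \<open>x - y\<close>.\<close>
    also have "\<dots> = (\<integral>\<^sup>+y. \<integral>\<^sup>+x. indicator A (x - y) * indicator E x \<partial>N \<partial>lborel)"
    proof (rule nn_integral_cong)
      fix y :: 'a
      have "(\<integral>\<^sup>+x. indicator A (x - y) * indicator E x \<partial>N)
          = (\<integral>\<^sup>+x. indicator A (x - y) * indicator E x \<partial>distr N borel ((+) y))"
        by (simp add: transN)
      also have "\<dots> = (\<integral>\<^sup>+x. indicator A x * indicator E (x + y) \<partial>N)"
        by (subst nn_integral_distr) (auto simp: add.commute)
      finally show "(\<integral>\<^sup>+x. indicator A x * indicator E (x + y) \<partial>N)
          = (\<integral>\<^sup>+x. indicator A (x - y) * indicator E x \<partial>N)" by (rule sym)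
    qed
    also have "\<dots> = (\<integral>\<^sup>+x. \<integral>\<^sup>+y. indicator A (x - y) * indicator E x \<partial>lborel \<partial>N)"
      by (rule P.Fubini') measurable
    also have "\<dots> = emeasure lborel (uminus -` A) * emeasure N E"
    proof -
      have "(\<integral>\<^sup>+y. indicator A (x - y) * indicator E x \<partial>lborel) = emeasure lborel (uminus -` A) * indicator E x"
        for x
      proof -
        have [measurable]: "uminus -` A \<in> sets borel"
          using measurable_sets[of uminus borel borel A] by simp
        have "(\<integral>\<^sup>+y. indicator A (x - y) * indicator E x \<partial>lborel)
           = (\<integral>\<^sup>+y. indicator A (x - y) * indicator E x \<partial>distr lborel borel ((+) x))"
          by (simp add: lborel_distr_plus)
        also have "\<dots> = (\<integral>\<^sup>+y. indicator (uminus -` A) y * indicator E x \<partial>lborel)"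
          by (subst nn_integral_distr) (auto intro!: nn_integral_cong simp: indicator_def)
        also have "\<dots> = emeasure lborel (uminus -` A) * indicator E x"
          by (subst nn_integral_multc) auto
        finally show ?thesis .
      qed
      then show ?thesis
        by (simp add: nn_integral_cmult setsN)
    qed
    finally show ?thesis .
  qed
  have fin: "emeasure lborel (ball (0::'a) 1) \<noteq> 0" "emeasure lborel (ball (0::'a) 1) \<noteq> \<infinity>"
    by (simp_all add: emeasure_ball ennreal_eq_0_iff not_le)
  have "emeasure N A = emeasure lborel A" if A: "A \<in> sets borel" for A
  proof -
    have "distr lborel borel (uminus :: 'a \<Rightarrow> 'a) = lborel"
      using lborel_affine[of "-1" "0::'a"] by (simp add: density_1)
    then have "emeasure lborel (uminus -` A) = emeasure lborel A"
      using A emeasure_distr[of uminus lborel borel A] by simp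
    then have "emeasure N A * emeasure lborel (ball (0::'a) 1)
        = emeasure lborel A * emeasure lborel (ball (0::'a) 1)"
      using eq[OF A, of "ball 0 1"] by (simp add: ballN)
    then show ?thesis
      using fin by (metis ennreal_mult_divide_eq infinity_ennreal_def)
  qed
  then have "N = lborel"
    by (intro measure_eqI) (auto simp: setsN)
  then show ?thesis by (simp add: N_def)
qed

text \<open>
  Integration in polar coordinates for radial functions.  The two measures agree on every
  half-line \<open>{..a}\<close> because \<open>d w\<^sub>d r\<^sup>d\<^sup>-\<^sup>1\<close> is the derivative of the volume \<open>w\<^sub>d r\<^sup>d\<close> of a ball.
\<close>
lemma distr_norm_lborel:
  "distr lborel borel (norm :: 'a::euclidean_space \<Rightarrow> real) =
     density lborel (\<lambda>r. ennreal (real DIM('a) * unit_ball_vol (real DIM('a)) * r ^ (DIM('a) - 1))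
       * indicator {0..} r)"
proof (rule measure_eqI_generator_eq[where E = "range atMost" and \<Omega> = UNIV and A = "\<lambda>n. {..real n}"])
  define d where "d = DIM('a)"
  define w where "w = unit_ball_vol (real d)"
  have d: "d > 0" by (simp add: d_def)
  have w: "w \<ge> 0" by (simp add: w_def)
  have L: "emeasure (distr lborel borel (norm :: 'a \<Rightarrow> real)) {..a} = (if a \<ge> 0 then ennreal (w * a ^ d) else 0)"
    for a :: real
  proof -
    have "norm -` {..a} = cball (0::'a) a" by auto
    then have "emeasure (distr lborel borel (norm :: 'a \<Rightarrow> real)) {..a} = emeasure lborel (cball (0::'a) a)"
      by (simp add: emeasure_distr)
    also have "\<dots> = (if a \<ge> 0 then ennreal (w * a ^ d) else 0)"
      by (auto simp: emeasure_cball w_def d_def)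
    finally show ?thesis .
  qed
  have R: "emeasure (density lborel (\<lambda>r. ennreal (real d * w * r ^ (d - 1)) * indicator {0..} r)) {..a} =
      (if a \<ge> 0 then ennreal (w * a ^ d) else 0)" for a :: real
  proof (cases "a \<ge> 0")
    case True
    have "emeasure (density lborel (\<lambda>r. ennreal (real d * w * r ^ (d - 1)) * indicator {0..} r)) {..a}
       = (\<integral>\<^sup>+r. ennreal (real d * w * r ^ (d - 1)) * indicator {0..a} r \<partial>lborel)"
      by (subst emeasure_density) (auto intro!: nn_integral_cong simp: indicator_def)
    also have "\<dots> = ennreal (w * a ^ d - w * 0 ^ d)"
      using True w by (intro nn_integral_FTC_Icc) (auto intro!: derivative_eq_intros)
    finally show ?thesis using True d by (simp add: power_0_left)
  next
    case False
    then have "emeasure (density lborel (\<lambda>r. ennreal (real d * w * r ^ (d - 1)) * indicator {0..} r)) {..a}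
       = (\<integral>\<^sup>+r. 0 \<partial>(lborel::real measure))"
      using False by (subst emeasure_density) (auto intro!: nn_integral_cong simp del: nn_integral_const simp: indicator_def)
    then show ?thesis using False by simp
  qed
  show "Int_stable (range (atMost :: real \<Rightarrow> _))"
    by (auto simp: Int_stable_def)
  show "emeasure (distr lborel borel (norm :: 'a \<Rightarrow> real)) X =
    emeasure (density lborel (\<lambda>r. ennreal (real DIM('a) * unit_ball_vol (real DIM('a)) * r ^ (DIM('a) - 1))
       * indicator {0..} r)) X" if "X \<in> range atMost" for X
    using that L R by (auto simp: d_def w_def)
  show "(\<Union>i. {..real i}) = UNIV"
    by (auto intro: real_arch_simple)
  show "emeasure (distr lborel borel (norm :: 'a \<Rightarrow> real)) {..real n} \<noteq> \<infinity>" for n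
    by (simp add: L)
qed (auto simp: borel_eq_atMost)

lemma nn_integral_norm_lborel:
  fixes f :: "real \<Rightarrow> ennreal"
  assumes [measurable]: "f \<in> borel_measurable borel"
  shows "(\<integral>\<^sup>+x. f (norm (x::'a::euclidean_space)) \<partial>lborel)
    = (\<integral>\<^sup>+r. f r * (ennreal (real DIM('a) * unit_ball_vol (real DIM('a)) * r ^ (DIM('a) - 1)) * indicator {0..} r) \<partial>lborel)"
proof -
  have "(\<integral>\<^sup>+x. f (norm (x::'a)) \<partial>lborel) = (\<integral>\<^sup>+r. f r \<partial>distr lborel borel (norm :: 'a \<Rightarrow> real))"
    by (subst nn_integral_distr) auto
  then show ?thesis
    unfolding distr_norm_lborel by (subst (asm) nn_integral_density) (auto simp: mult.commute)
qed

text \<open>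
  Tonelli's theorem along the coordinate axis \<open>b\<close>; the cross-section is the ball of
  one dimension less, whose volume is known in the form
  \<open>emeasure_cball_aux\<close> for functions on an arbitrary finite index set.
\<close>
lemma emeasure_cylinder:
  fixes b :: "'a::euclidean_space"
  assumes b: "b \<in> Basis" and "l \<le> u" "\<rho> > 0"
  shows "emeasure lborel {x. l < x \<bullet> b \<and> x \<bullet> b \<le> u \<and> norm (x - (x \<bullet> b) *\<^sub>R b) \<le> \<rho>}
    = ennreal ((u - l) * (unit_ball_vol (real (DIM('a) - 1)) * \<rho> ^ (DIM('a) - 1)))"
    (is "emeasure lborel ?C = _")
proof -
  define I where "I = Basis - {b}"
  have I: "finite I" "b \<notin> I" "Basis = insert b I" "card I = DIM('a) - 1"
    using b by (auto simp: I_def)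
  interpret product_sigma_finite "\<lambda>_::'a. lborel :: real measure"
    by standard
  let ?D = "{f. sqrt (\<Sum>i\<in>I. (f i)\<^sup>2) \<le> \<rho>} \<inter> space (Pi\<^sub>M I (\<lambda>_. lborel))"
  have C [measurable]: "?C \<in> sets borel" by measurable
  have nrm: "norm (x - (x \<bullet> b) *\<^sub>R b) = sqrt (\<Sum>i\<in>I. (x \<bullet> i)\<^sup>2)" for x
  proof -
    have "norm (x - (x \<bullet> b) *\<^sub>R b) = sqrt (\<Sum>i\<in>Basis. ((x - (x \<bullet> b) *\<^sub>R b) \<bullet> i)\<^sup>2)"
      using euclidean_dist_l2[of "x - (x \<bullet> b) *\<^sub>R b" 0] by (simp add: L2_set_def)
    also have "(\<Sum>i\<in>Basis. ((x - (x \<bullet> b) *\<^sub>R b) \<bullet> i)\<^sup>2) = (\<Sum>i\<in>I. ((x - (x \<bullet> b) *\<^sub>R b) \<bullet> i)\<^sup>2)"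
      unfolding I(3) by (subst sum.insert) (use I b in \<open>auto simp: inner_diff_left\<close>)
    also have "\<dots> = (\<Sum>i\<in>I. (x \<bullet> i)\<^sup>2)"
      using I b by (intro sum.cong) (auto simp: inner_diff_left inner_not_same_Basis I_def)
    finally show ?thesis .
  qed
  have "emeasure lborel ?C = (\<integral>\<^sup>+x. indicator ?C x \<partial>lborel)"
    by simp
  also have "\<dots> = (\<integral>\<^sup>+f. indicator ?C (\<Sum>c\<in>Basis. f c *\<^sub>R c) \<partial>Pi\<^sub>M (insert b I) (\<lambda>_. lborel))"
    by (subst lborel_eq, subst nn_integral_distr) (auto simp: I(3))
  also have "\<dots> = (\<integral>\<^sup>+y. \<integral>\<^sup>+f. indicator ?C (\<Sum>c\<in>Basis. (f(b := y)) c *\<^sub>R c) \<partial>Pi\<^sub>M I (\<lambda>_. lborel) \<partial>lborel)"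
    using I(1,2) by (subst product_nn_integral_insert_rev) (auto simp: I(3)[symmetric] simp del: fun_upd_apply)
  also have "\<dots> = (\<integral>\<^sup>+y. \<integral>\<^sup>+f. indicator {l<..u} y * indicator ?D f \<partial>Pi\<^sub>M I (\<lambda>_. lborel) \<partial>lborel)"
  proof (intro nn_integral_cong)
    fix y :: real and f :: "'a \<Rightarrow> real"
    assume f: "f \<in> space (Pi\<^sub>M I (\<lambda>_. lborel))"
    let ?x = "\<Sum>c\<in>Basis. (f(b := y)) c *\<^sub>R c"
    have inn: "?x \<bullet> i = (if i = b then y else f i)" if "i \<in> Basis" for i
      using that by (subst inner_sum_left_Basis) auto
    have "(\<Sum>i\<in>I. (?x \<bullet> i)\<^sup>2) = (\<Sum>i\<in>I. (f i)\<^sup>2)"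
      by (intro sum.cong refl) (subst inn, auto simp: I_def)
    then have "?x \<in> ?C \<longleftrightarrow> y \<in> {l<..u} \<and> f \<in> ?D"
      using inn[OF b] f nrm[of ?x] by auto
    then show "indicator ?C ?x = (indicator {l<..u} y * indicator ?D f :: ennreal)"
      by (auto simp: indicator_def)
  qed
  also have "\<dots> = (\<integral>\<^sup>+y. indicator {l<..u} y * emeasure (Pi\<^sub>M I (\<lambda>_. lborel)) ?D \<partial>lborel)"
    using I(1) by (intro nn_integral_cong, subst nn_integral_cmult) auto
  also have "\<dots> = emeasure lborel {l<..u} * emeasure (Pi\<^sub>M I (\<lambda>_. lborel)) ?D"
    by (subst nn_integral_multc) auto
  also have "\<dots> = ennreal (u - l) * ennreal (unit_ball_vol (real (card I)) * \<rho> ^ card I)"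
    using assms I(1) by (subst emeasure_cball_aux) auto
  finally show ?thesis
    using assms by (simp add: I(4) ennreal_mult')
qed

section \<open>Covariance of the unit ball\<close>

lemma mem_translation_iff: "x \<in> (\<lambda>x. x + z) ` A \<longleftrightarrow> x - z \<in> A" for x :: "'a::group_add"
  by (metis (no_types, lifting) add_diff_cancel diff_add_cancel image_iff)

lemma measure_lborel_translation:
  fixes A :: "'a::euclidean_space set"
  assumes "A \<in> sets borel"
  shows "measure lborel ((\<lambda>x. x + z) ` A) = measure lborel A"
proof -
  have "(\<lambda>x. x + z) ` A = (+) (- z) -` A"
    by (rule set_eqI) (simp only: mem_translation_iff vimage_eq, simp)
  then have "measure lborel ((\<lambda>x. x + z) ` A) = measure (distr lborel borel ((+) (- z))) A"
    using assms by (simp add: measure_distr)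
  then show ?thesis by (simp add: lborel_distr_plus)
qed

text \<open>
  \<open>B \<inter> (B + z)\<close> is the intersection of two balls with centres \<open>0\<close> and \<open>z\<close>, and an
  isometry fixing the origin carries it to the one for the image of \<open>z\<close>.
\<close>
lemma set_covariance_orthogonal:
  fixes f :: "'a::euclidean_space \<Rightarrow> 'a"
  assumes f: "orthogonal_transformation f"
  shows "set_covariance (ball 0 r) (f z) = set_covariance (ball 0 r) z"
proof -
  have nf: "norm (f x) = norm x" for x
    using f by (simp add: orthogonal_transformation_norm)
  have lin: "linear f"
    using f by (simp add: orthogonal_transformation_linear)
  have [measurable]: "f \<in> borel_measurable borel"
    using lin by (intro borel_measurable_continuous_onI linear_continuous_on)
      (simp add: linear_conv_bounded_linear)
  have tr: "(\<lambda>x. x + v) ` ball 0 r = ball v r" for v :: 'a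
  proof -
    have "(\<lambda>x. x + v) ` ball 0 r = (+) (- v) -` ball 0 r"
      by (rule set_eqI) (simp only: mem_translation_iff vimage_eq, simp)
    also have "\<dots> = ball v r"
      by (simp add: set_eq_iff dist_norm norm_minus_commute)
    finally show ?thesis .
  qed
  have "f -` (ball 0 r \<inter> ball (f z) r) = ball 0 r \<inter> ball z r"
    by (auto simp: nf dist_norm linear_diff[OF lin, symmetric])
  then have "measure (distr lborel borel f) (ball 0 r \<inter> ball (f z) r) = measure lborel (ball 0 r \<inter> ball z r)"
    by (subst measure_distr) auto
  then show ?thesis
    by (simp add: lborel_distr_orthogonal[OF f] set_covariance_def tr)
qed

text \<open>
  Half open in the direction \<open>b\<close>, so that the slab and the two remaining caps partition the
  unit ball.
\<close>
definition slab :: "'a::euclidean_space \<Rightarrow> real \<Rightarrow> 'a set" where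
  "slab b r = ball 0 1 \<inter> {x. - r / 2 < x \<bullet> b \<and> x \<bullet> b \<le> r / 2}"

lemma slab_measurable [measurable]: "slab b r \<in> sets borel"
  unfolding slab_def by measurable

lemma slab_finite: "emeasure lborel (slab b r) < \<infinity>"
  using emeasure_mono[of "slab b r" "ball 0 1" lborel] emeasure_lborel_ball_finite[of 0 1]
  by (auto simp: slab_def intro: le_less_trans)

lemma slab_fmeasurable: "slab b r \<in> fmeasurable lborel"
  using slab_finite by (intro fmeasurableI) auto

lemma set_covariance_zero: "set_covariance A 0 = measure lborel A"
  by (simp add: set_covariance_def)

text \<open>
  The bisecting hyperplane \<open>x \<bullet> b = r / 2\<close> cuts the lens \<open>B \<inter> (B + r b)\<close> into two caps: the
  points of \<open>B\<close> beyond the hyperplane lie automatically in \<open>B + r b\<close>, since they are closer to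
  \<open>r b\<close> than to \<open>0\<close>, and conversely on the other side.  Translating the second cap back by
  \<open>r b\<close> makes it the opposite cap of \<open>B\<close>, and what the two caps leave of \<open>B\<close> is the slab.
  This turns a difference of volumes of order one into a single volume of order \<open>r\<close>.
\<close>
lemma ball_covariance_drop_eq_slab:
  fixes b :: "'a::euclidean_space"
  assumes b: "norm b = 1" and r: "r \<ge> 0"
  shows "set_covariance (ball 0 1) (0::'a) - set_covariance (ball 0 1) (r *\<^sub>R b) = measure lborel (slab b r)"
proof (cases "r = 0")
  case True
  have "slab b 0 = {}" by (force simp: slab_def)
  then show ?thesis by (simp add: True)
next
  case False
  with r have r: "r > 0" by simp
  let ?B = "ball 0 1 :: 'a set"
  let ?z = "r *\<^sub>R b"
  let ?U = "?B \<inter> {x. x \<bullet> b > r / 2}" and ?L = "?B \<inter> {x. x \<bullet> b \<le> - r / 2}"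
  have fin: "A \<in> fmeasurable lborel" if "A \<in> sets borel" "A \<subseteq> ?B" for A
  proof (rule fmeasurableI2)
    show "?B \<in> fmeasurable lborel"
      using emeasure_lborel_ball_finite[of "0::'a" 1] by (intro fmeasurableI) auto
  qed (use that in simp_all)
  have bb: "b \<bullet> b = 1"
    using b unfolding norm_eq_1 .
  have sq: "(norm (x - ?z))\<^sup>2 = (norm x)\<^sup>2 - 2 * r * (x \<bullet> b) + r\<^sup>2" for x
    unfolding power2_norm_eq_inner
    by (simp add: inner_diff_left inner_diff_right bb inner_commute[of b x] power2_eq_square algebra_simps)
  have lt1: "norm y < 1 \<longleftrightarrow> (norm y)\<^sup>2 < 1" for y :: 'a
    by (simp add: abs_square_less_1)
  note mem = mem_translation_iff[of _ ?z]
  have closer: "norm (x - ?z) < 1" if "norm x < 1" "x \<bullet> b > r / 2" for x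
  proof -
    have "r * (r / 2) \<le> r * (x \<bullet> b)"
      using that r by (intro mult_left_mono) auto
    then have "(norm (x - ?z))\<^sup>2 \<le> (norm x)\<^sup>2"
      unfolding sq by (simp add: power2_eq_square)
    with that show ?thesis unfolding lt1 by linarith
  qed
  have farther: "norm x < 1" if "norm (x - ?z) < 1" "x \<bullet> b \<le> r / 2" for x
  proof -
    have "r * (x \<bullet> b) \<le> r * (r / 2)"
      using that r by (intro mult_left_mono) auto
    then have "(norm x)\<^sup>2 \<le> (norm (x - ?z))\<^sup>2"
      unfolding sq by (simp add: power2_eq_square)
    with that show ?thesis unfolding lt1 by linarith
  qed
  have eq: "?B \<inter> (\<lambda>x. x + ?z) ` ?B = ?U \<union> (\<lambda>x. x + ?z) ` ?L"
  proof (rule set_eqI)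
    fix x
    have L: "x - ?z \<in> ?L \<longleftrightarrow> norm (x - ?z) < 1 \<and> x \<bullet> b \<le> r / 2"
      by (auto simp: inner_diff_left bb)
    have "x \<in> ?B \<inter> (\<lambda>x. x + ?z) ` ?B \<longleftrightarrow> norm x < 1 \<and> norm (x - ?z) < 1"
      unfolding Int_iff mem by simp
    also have "\<dots> \<longleftrightarrow> (norm x < 1 \<and> x \<bullet> b > r / 2) \<or> (norm (x - ?z) < 1 \<and> x \<bullet> b \<le> r / 2)"
      using closer[of x] farther[of x] by (cases "x \<bullet> b > r / 2") (auto simp: not_less)
    also have "\<dots> \<longleftrightarrow> x \<in> ?U \<union> (\<lambda>x. x + ?z) ` ?L"
      unfolding Un_iff mem L by simp
    finally show "x \<in> ?B \<inter> (\<lambda>x. x + ?z) ` ?B \<longleftrightarrow> x \<in> ?U \<union> (\<lambda>x. x + ?z) ` ?L" .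
  qed
  have tr: "(\<lambda>x. x + ?z) ` ?L = (+) (- ?z) -` ?L"
    by (rule set_eqI) (simp only: mem_translation_iff vimage_eq, simp)
  have U [measurable]: "?U \<in> sets borel" and L [measurable]: "?L \<in> sets borel"
    by measurable
  have tL [measurable]: "(\<lambda>x. x + ?z) ` ?L \<in> sets borel"
    using measurable_sets[of "(+) (- ?z)" borel borel ?L] L unfolding tr by simp
  have "set_covariance ?B ?z = measure lborel ?U + measure lborel ((\<lambda>x. x + ?z) ` ?L)"
    unfolding set_covariance_def eq
  proof (rule measure_Un_AE)
    show "AE x in lborel. x \<notin> ?U \<or> x \<notin> (\<lambda>x. x + ?z) ` ?L"
      unfolding mem by (rule AE_I2) (auto simp: inner_diff_left bb)
    show "?U \<in> fmeasurable lborel" by (rule fin[OF U]) auto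
    show "(\<lambda>x. x + ?z) ` ?L \<in> fmeasurable lborel"
      by (rule fin[OF tL]) (use eq in blast)
  qed
  then have cov: "set_covariance ?B ?z = measure lborel ?U + measure lborel ?L"
    unfolding measure_lborel_translation[OF L] .
  have "?B = ?U \<union> ?L \<union> slab b r"
    by (auto simp: slab_def)
  then have "measure lborel ?B = measure lborel (?U \<union> ?L \<union> slab b r)"
    by (rule arg_cong)
  also have "\<dots> = measure lborel (?U \<union> ?L) + measure lborel (slab b r)"
  proof (rule measure_Un_AE)
    show "AE x in lborel. x \<notin> ?U \<union> ?L \<or> x \<notin> slab b r"
      unfolding slab_def by (rule AE_I2) auto
    show "?U \<union> ?L \<in> fmeasurable lborel"
      by (intro fin sets.Un U L) auto
  qed (rule slab_fmeasurable)
  also have "measure lborel (?U \<union> ?L) = measure lborel ?U + measure lborel ?L"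
  proof (rule measure_Un_AE)
    show "AE x in lborel. x \<notin> ?U \<or> x \<notin> ?L"
      using r by (intro AE_I2) auto
    show "?U \<in> fmeasurable lborel" by (rule fin[OF U]) auto
    show "?L \<in> fmeasurable lborel" by (rule fin[OF L]) auto
  qed
  finally show ?thesis
    unfolding cov set_covariance_zero by linarith
qed

lemma mono_measure_slab: "mono (\<lambda>r. measure lborel (slab b r))"
proof (rule monoI)
  fix r s :: real assume "r \<le> s"
  then have "slab b r \<subseteq> slab b s" by (auto simp: slab_def)
  then show "measure lborel (slab b r) \<le> measure lborel (slab b s)"
    by (intro measure_mono_fmeasurable slab_fmeasurable) auto
qed

lemma slab_eq_ball:
  fixes b :: "'a::euclidean_space"
  assumes "norm b = 1" "r \<ge> 2"
  shows "slab b r = ball 0 1"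
proof -
  have cs: "\<bar>x \<bullet> b\<bar> \<le> norm x" for x :: 'a
    using Cauchy_Schwarz_ineq2[of x b] assms by simp
  show ?thesis
  proof (intro equalityI subsetI)
    fix x :: 'a assume x: "x \<in> ball 0 1"
    then have "\<bar>x \<bullet> b\<bar> < 1"
      using cs[of x] by simp
    then have "- r / 2 < x \<bullet> b" "x \<bullet> b \<le> r / 2"
      using assms by linarith+
    with x show "x \<in> slab b r" by (simp add: slab_def)
  qed (auto simp: slab_def)
qed

lemma norm_power2_split_along_unit:
  fixes b :: "'a::euclidean_space"
  assumes "norm b = 1"
  shows "(norm x)\<^sup>2 = (x \<bullet> b)\<^sup>2 + (norm (x - (x \<bullet> b) *\<^sub>R b))\<^sup>2"
  using assms unfolding power2_norm_eq_inner
  by (simp add: inner_diff algebra_simps power2_eq_square inner_commute norm_eq_1)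

text \<open>
  The slab lies in the cylinder of the same height whose base is the unit ball of dimension
  \<open>d - 1\<close>.
\<close>
lemma measure_slab_le:
  fixes b :: "'a::euclidean_space"
  assumes b: "b \<in> Basis" and r: "r \<ge> 0"
  shows "measure lborel (slab b r) \<le> r * unit_ball_vol (real (DIM('a) - 1))"
proof -
  let ?C = "{x. - r / 2 < x \<bullet> b \<and> x \<bullet> b \<le> r / 2 \<and> norm (x - (x \<bullet> b) *\<^sub>R b) \<le> 1}"
  have em: "emeasure lborel ?C = ennreal (r * unit_ball_vol (real (DIM('a) - 1)))"
    using emeasure_cylinder[OF b, of "- r / 2" "r / 2" 1] r by simp
  have "slab b r \<subseteq> ?C"
  proof
    fix x assume x: "x \<in> slab b r"
    have "(norm (x - (x \<bullet> b) *\<^sub>R b))\<^sup>2 \<le> 1\<^sup>2"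
      using norm_power2_split_along_unit[of b x] b x abs_square_less_1[of "norm x"]
      by (auto simp: slab_def intro: order_trans[of _ "(norm x)\<^sup>2"])
    then have "norm (x - (x \<bullet> b) *\<^sub>R b) \<le> 1"
      by (rule power2_le_imp_le) simp
    with x show "x \<in> ?C" by (auto simp: slab_def)
  qed
  then have "measure lborel (slab b r) \<le> measure lborel ?C"
    using em by (intro measure_mono_fmeasurable fmeasurableI) auto
  also have "\<dots> = r * unit_ball_vol (real (DIM('a) - 1))"
    using em r by (simp add: measure_def)
  finally show ?thesis .
qed

text \<open>
  The slab contains a cylinder of the same height and slightly smaller radius \<open>\<rho>\<close>.  The choice
  \<open>\<rho> = 1 - r\<^sup>2 / 4\<close>, instead of the sharp \<open>\<rho> = sqrt (1 - r\<^sup>2 / 4)\<close>, keeps the cylinder inside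
  the open ball and makes Bernoulli's inequality applicable to \<open>\<rho>\<^sup>d\<^sup>-\<^sup>1\<close>.  Together with the
  upper bound this shows that the slab has volume \<open>w\<^sub>d\<^sub>-\<^sub>1 r + O(r\<^sup>3)\<close>.
\<close>
lemma measure_slab_ge:
  fixes b :: "'a::euclidean_space"
  assumes b: "b \<in> Basis" and r: "0 < r" "r < 2"
  shows "r * unit_ball_vol (real (DIM('a) - 1)) * (1 - (real DIM('a) - 1) * (r\<^sup>2 / 4)) \<le> measure lborel (slab b r)"
proof -
  define \<rho> where "\<rho> = 1 - r\<^sup>2 / 4"
  have "r\<^sup>2 < 2\<^sup>2" using r by (intro power_strict_mono) auto
  then have \<rho>: "0 < \<rho>" "\<rho> < 1" using r by (auto simp: \<rho>_def)
  let ?C = "{x. - r / 2 < x \<bullet> b \<and> x \<bullet> b \<le> r / 2 \<and> norm (x - (x \<bullet> b) *\<^sub>R b) \<le> \<rho>}"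
  have em: "emeasure lborel ?C = ennreal (r * (unit_ball_vol (real (DIM('a) - 1)) * \<rho> ^ (DIM('a) - 1)))"
    using emeasure_cylinder[OF b, of "- r / 2" "r / 2" \<rho>] r \<rho> by simp
  have sub: "?C \<subseteq> slab b r"
  proof
    fix x assume x: "x \<in> ?C"
    then have "\<bar>x \<bullet> b\<bar> \<le> r / 2" by auto
    then have 1: "(x \<bullet> b)\<^sup>2 \<le> (r / 2)\<^sup>2" using r by (simp add: abs_le_square_iff[symmetric])
    have "(norm (x - (x \<bullet> b) *\<^sub>R b))\<^sup>2 \<le> \<rho>\<^sup>2"
      using x by (intro power_mono) auto
    also have "\<rho>\<^sup>2 < \<rho>" using \<rho> by (simp add: power2_eq_square)
    finally have "(norm x)\<^sup>2 < 1\<^sup>2"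
      using norm_power2_split_along_unit[of b x] b 1 by (auto simp: \<rho>_def power_divide)
    then have "norm x < 1"
      by (rule power2_less_imp_less) simp
    with x show "x \<in> slab b r" by (auto simp: slab_def)
  qed
  have "1 + real (DIM('a) - 1) * (- (r\<^sup>2 / 4)) \<le> (1 + (- (r\<^sup>2 / 4))) ^ (DIM('a) - 1)"
    using \<rho> by (intro Bernoulli_inequality) (auto simp: \<rho>_def)
  then have "r * unit_ball_vol (real (DIM('a) - 1)) * (1 - (real DIM('a) - 1) * (r\<^sup>2 / 4))
      \<le> r * unit_ball_vol (real (DIM('a) - 1)) * \<rho> ^ (DIM('a) - 1)"
    using r by (intro mult_left_mono) (auto simp: \<rho>_def of_nat_diff Suc_le_eq)
  also have "\<dots> = measure lborel ?C"
    using em r \<rho> by (simp add: measure_def)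
  also have "\<dots> \<le> measure lborel (slab b r)"
    by (intro measure_mono_fmeasurable slab_fmeasurable sub) measurable
  finally show ?thesis .
qed

section \<open>Asymptotics of the radial integral\<close>

lemma integral_at_right_0_dominated_convergence:
  fixes s :: "real \<Rightarrow> 'a \<Rightarrow> real"
  assumes "f \<in> borel_measurable M" "\<And>t. t > 0 \<Longrightarrow> s t \<in> borel_measurable M" "integrable M w"
    and lim: "\<And>x. ((\<lambda>t. s t x) \<longlongrightarrow> f x) (at_right 0)"
    and bound: "\<And>t x. t > 0 \<Longrightarrow> \<bar>s t x\<bar> \<le> w x"
  shows "((\<lambda>t. integral\<^sup>L M (s t)) \<longlongrightarrow> integral\<^sup>L M f) (at_right 0)"
  unfolding tendsto_at_iff_sequentially
proof (intro allI impI)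
  fix X :: "nat \<Rightarrow> real"
  assume X: "\<forall>i. X i \<in> {0<..} - {0}" "X \<longlonglongrightarrow> 0"
  then have pos: "X i > 0" for i by auto
  have "(\<lambda>i. integral\<^sup>L M (s (X i))) \<longlonglongrightarrow> integral\<^sup>L M f"
  proof (rule integral_dominated_convergence)
    show "AE x in M. (\<lambda>i. s (X i) x) \<longlonglongrightarrow> f x"
      using lim X by (auto simp: tendsto_at_iff_sequentially o_def)
    show "AE x in M. norm (s (X i) x) \<le> w x" for i
      using bound pos by auto
  qed (use assms pos in auto)
  then show "((\<lambda>t. integral\<^sup>L M (s t)) \<circ> X) \<longlonglongrightarrow> integral\<^sup>L M f"
    by (simp add: o_def)
qed

lemma sqrt_sum_squares_power:
  fixes t r :: real
  assumes "t > 0"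
  shows "(t\<^sup>2 + r\<^sup>2) powr (real n / 2) = sqrt (t\<^sup>2 + r\<^sup>2) ^ n"
proof -
  have "t\<^sup>2 + r\<^sup>2 > 0" using assms by (simp add: add_pos_nonneg)
  then have "(t\<^sup>2 + r\<^sup>2) powr (1 / 2 * real n) = (sqrt (t\<^sup>2 + r\<^sup>2)) ^ n"
    by (simp only: powr_powr[symmetric] powr_half_sqrt less_imp_le powr_realpow real_sqrt_gt_zero)
  then show ?thesis by simp
qed

lemma set_integrable_inverse_square:
  "set_integrable lborel {2..} (\<lambda>r::real. 1 / r\<^sup>2)"
  "(LBINT r:{2..}. 1 / r\<^sup>2) = (1 / 2 :: real)"
proof -
  have eq: "(\<integral>\<^sup>+r. ennreal (1 / r\<^sup>2) * indicator {2..} r \<partial>lborel) = ennreal (0 - (- 1 / 2))"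
    by (rule nn_integral_FTC_atLeast[where F = "\<lambda>r. - 1 / r"])
      (auto intro!: derivative_eq_intros simp: power2_eq_square, real_asymp)
  then have nn: "(\<integral>\<^sup>+r. ennreal (indicator {2..} r *\<^sub>R (1 / r\<^sup>2)) \<partial>lborel) = ennreal (1 / 2)"
  proof -
    have "(\<integral>\<^sup>+r. ennreal (indicator {2..} r *\<^sub>R (1 / r\<^sup>2)) \<partial>lborel)
        = (\<integral>\<^sup>+r. ennreal (1 / r\<^sup>2) * indicator {2..} r \<partial>lborel)"
      by (intro nn_integral_cong) (auto simp: indicator_def)
    with eq show ?thesis by simp
  qed
  show "set_integrable lborel {2..} (\<lambda>r::real. 1 / r\<^sup>2)"
    unfolding set_integrable_def
  proof (rule integrableI_nonneg)
    show "(\<integral>\<^sup>+r. ennreal (indicator {2..} r *\<^sub>R (1 / r\<^sup>2)) \<partial>lborel) < \<infinity>"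
      unfolding nn infinity_ennreal_def by (rule ennreal_less_top)
  qed auto
  show "(LBINT r:{2..}. 1 / r\<^sup>2) = (1 / 2 :: real)"
  proof -
    have "(LBINT r:{2::real..}. 1 / r\<^sup>2) = enn2real (\<integral>\<^sup>+r. ennreal (indicator {2..} r *\<^sub>R (1 / r\<^sup>2)) \<partial>lborel)"
      unfolding set_lebesgue_integral_def by (rule integral_eq_nn_integral) auto
    then show ?thesis unfolding nn by (simp only: enn2real_ennreal)
  qed
qed

lemma tanh_arsinh_real: "tanh (arsinh x) = x / sqrt (x\<^sup>2 + 1)" for x :: real
proof -
  have "cosh (arsinh x) = sqrt (x\<^sup>2 + 1)"
    using cosh_square_eq[of "arsinh x"] cosh_real_nonneg[of "arsinh x"]
    by (metis real_sqrt_abs abs_of_nonneg sinh_arsinh_real)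
  then show ?thesis by (simp add: tanh_def)
qed

text \<open>
  Substitute \<open>r = t sinh \<theta>\<close>, that is \<open>\<theta> = arsinh (r / t)\<close>, for which
  \<open>d\<theta> = dr / sqrt (t\<^sup>2 + r\<^sup>2)\<close> and \<open>tanh \<theta> = r / sqrt (t\<^sup>2 + r\<^sup>2)\<close>.
\<close>
lemma integral_power_div_sqrt_eq_tanh:
  assumes t: "(t::real) > 0"
  shows "(LBINT r=0..2. r ^ d / sqrt (t\<^sup>2 + r\<^sup>2) ^ (d + 1)) = (LBINT \<theta>=0..arsinh (2 / t). tanh \<theta> ^ d)"
proof -
  have s: "sqrt ((r / t)\<^sup>2 + 1) = sqrt (t\<^sup>2 + r\<^sup>2) / t" for r
  proof -
    have "(r / t)\<^sup>2 + 1 = (t\<^sup>2 + r\<^sup>2) / t\<^sup>2" using t by (simp add: field_simps)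
    then show ?thesis using t by (simp add: real_sqrt_divide)
  qed
  have th: "tanh (arsinh (r / t)) = r / sqrt (t\<^sup>2 + r\<^sup>2)" for r
    unfolding tanh_arsinh_real s using t by simp
  have pos: "t\<^sup>2 + r\<^sup>2 > 0" for r using t by (simp add: add_pos_nonneg)
  have "(LBINT r=ereal 0..ereal 2. (1 / sqrt (t\<^sup>2 + r\<^sup>2)) *\<^sub>R tanh (arsinh (r / t)) ^ d)
      = (LBINT \<theta>=ereal (arsinh (0 / t))..ereal (arsinh (2 / t)). tanh \<theta> ^ d)"
  proof (rule interval_integral_substitution_finite[where g = "\<lambda>r. arsinh (r / t)"])
    show "((\<lambda>r. arsinh (r / t)) has_real_derivative 1 / sqrt (t\<^sup>2 + x\<^sup>2)) (at x within {0..2})" for x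
    proof -
      have "((\<lambda>r. arsinh (r / t)) has_real_derivative 1 / sqrt ((x / t)\<^sup>2 + 1) * (1 / t)) (at x)"
        by (rule DERIV_chain2[OF arsinh_real_has_field_derivative])
          (use t in \<open>auto intro!: derivative_eq_intros\<close>)
      then show ?thesis
        using t by (auto simp: s intro: has_field_derivative_at_within)
    qed
    show "continuous_on ((\<lambda>r. arsinh (r / t)) ` {0..2}) (\<lambda>\<theta>. tanh \<theta> ^ d)"
      by (intro continuous_intros) auto
    show "continuous_on {0..2} (\<lambda>r. 1 / sqrt (t\<^sup>2 + r\<^sup>2))"
      using pos by (intro continuous_intros) (auto simp: less_imp_neq[symmetric])
  qed auto
  also have "(LBINT r=ereal 0..ereal 2. (1 / sqrt (t\<^sup>2 + r\<^sup>2)) *\<^sub>R tanh (arsinh (r / t)) ^ d)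
      = (LBINT r=ereal 0..ereal 2. r ^ d / sqrt (t\<^sup>2 + r\<^sup>2) ^ (d + 1))"
    by (intro interval_integral_cong) (simp add: th power_divide)
  finally show ?thesis by (simp add: zero_ereal_def)
qed

lemma borel_measurable_tanh_real [measurable]: "(tanh :: real \<Rightarrow> real) \<in> borel_measurable borel"
  by (intro borel_measurable_continuous_onI continuous_intros) auto

text \<open>
  By Bernoulli's inequality, \<open>0 \<le> 1 - tanh\<^sup>d \<theta> \<le> d (1 - tanh \<theta>) \<le> 2 d exp (- 2 \<theta>)\<close>.
\<close>
lemma set_integrable_tanh_power_minus_one:
  "set_integrable lborel {0..} (\<lambda>\<theta>::real. tanh \<theta> ^ d - 1)"
proof -
  have bound: "\<bar>tanh \<theta> ^ d - 1\<bar> \<le> 2 * real d * exp (- 2 * \<theta>)" if "\<theta> \<ge> 0" for \<theta> :: real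
  proof -
    have th: "0 \<le> tanh \<theta>" "tanh \<theta> < 1" using that by (auto simp: tanh_real_lt_1)
    have "1 + real d * (tanh \<theta> - 1) \<le> (1 + (tanh \<theta> - 1)) ^ d"
      using th by (intro Bernoulli_inequality) auto
    then have "1 - tanh \<theta> ^ d \<le> real d * (1 - tanh \<theta>)"
      by (simp add: algebra_simps)
    also have "1 - tanh \<theta> = 2 * exp (- 2 * \<theta>) / (1 + exp (- 2 * \<theta>))"
      by (simp add: tanh_real_altdef field_simps add_pos_pos less_imp_neq[symmetric])
    also have "\<dots> \<le> 2 * exp (- 2 * \<theta>)"
      by (simp add: field_simps add_pos_pos)
    finally have "1 - tanh \<theta> ^ d \<le> real d * (2 * exp (- 2 * \<theta>))"
      by (simp add: mult_left_mono)
    moreover have "tanh \<theta> ^ d \<le> 1"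
      using th by (intro power_le_one) auto
    ultimately show ?thesis by simp
  qed
  have nn: "(\<integral>\<^sup>+\<theta>. ennreal (2 * real d * exp (- 2 * \<theta>)) * indicator {0..} \<theta> \<partial>lborel)
      = ennreal (0 - (- real d * exp (- 2 * 0)))"
    by (rule nn_integral_FTC_atLeast[where F = "\<lambda>\<theta>. - real d * exp (- 2 * \<theta>)"])
      (auto intro!: derivative_eq_intros, real_asymp)
  have "(\<integral>\<^sup>+\<theta>. ennreal (indicator {0..} \<theta> * (2 * real d * exp (- 2 * \<theta>))) \<partial>lborel)
      = (\<integral>\<^sup>+\<theta>. ennreal (2 * real d * exp (- 2 * \<theta>)) * indicator {0..} \<theta> \<partial>lborel)"
    by (intro nn_integral_cong) (auto simp: indicator_def)
  then have "integrable lborel (\<lambda>\<theta>. indicator {0..} \<theta> * (2 * real d * exp (- 2 * \<theta>)))"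
    using nn by (intro integrableI_nonneg) auto
  then show ?thesis
    unfolding set_integrable_def
  proof (rule Bochner_Integration.integrable_bound)
    show "(\<lambda>\<theta>::real. indicat_real {0..} \<theta> *\<^sub>R (tanh \<theta> ^ d - 1)) \<in> borel_measurable lborel"
      by measurable
    show "AE \<theta> in lborel. norm (indicat_real {0..} \<theta> *\<^sub>R (tanh \<theta> ^ d - 1))
        \<le> norm (indicat_real {0..} \<theta> * (2 * real d * exp (- 2 * \<theta>)))"
      using bound by (intro AE_I2) (auto simp: indicator_def)
  qed
qed

lemma tendsto_integral_tanh_power:
  "((\<lambda>x. (LBINT \<theta>=0..ereal x. tanh \<theta> ^ d) - x) \<longlongrightarrow> (LBINT \<theta>=0..\<infinity>. tanh \<theta> ^ d - 1)) at_top"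
proof -
  have cont: "continuous_on A (\<lambda>\<theta>::real. tanh \<theta> ^ d)" for A
    by (intro continuous_intros) auto
  have "((\<lambda>x. LBINT \<theta>:{0..x::real}. tanh \<theta> ^ d - 1) \<longlongrightarrow> (LBINT \<theta>:{0::real..}. tanh \<theta> ^ d - 1)) at_top"
    by (intro tendsto_set_lebesgue_integral_at_top set_integrable_tanh_power_minus_one) auto
  moreover have "(LBINT \<theta>:{0::real..}. tanh \<theta> ^ d - 1) = (LBINT \<theta>=0..\<infinity>. tanh \<theta> ^ d - (1::real))"
    unfolding interval_lebesgue_integral_0_infty set_lebesgue_integral_def
  proof (rule integral_cong_AE)
    show "AE \<theta> in lborel. indicator {0..} \<theta> *\<^sub>R (tanh \<theta> ^ d - 1) = indicator {0<..} \<theta> *\<^sub>R (tanh \<theta> ^ d - (1::real))"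
      using AE_lborel_singleton[of "0::real"] by eventually_elim (auto simp: indicator_def)
  qed measurable
  moreover have "\<forall>\<^sub>F x in at_top. (LBINT \<theta>:{0..x::real}. tanh \<theta> ^ d - 1) = (LBINT \<theta>=0..ereal x. tanh \<theta> ^ d) - x"
    using eventually_ge_at_top[of 0]
  proof eventually_elim
    case (elim x)
    have "(LBINT \<theta>:{0..x::real}. tanh \<theta> ^ d - 1) = (LBINT \<theta>:{0..x::real}. tanh \<theta> ^ d) - (LBINT \<theta>:{0..x::real}. 1)"
      by (intro set_integral_diff borel_integrable_atLeastAtMost') (auto intro: cont continuous_intros)
    also have "(LBINT \<theta>:{0..x::real}. 1) = x"
      using elim by (simp add: set_lebesgue_integral_def)
    also have "(LBINT \<theta>:{0..x::real}. tanh \<theta> ^ d) = (LBINT \<theta>=0..ereal x. tanh \<theta> ^ d)"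
      using elim by (simp add: interval_integral_Icc zero_ereal_def)
    finally show ?case .
  qed
  ultimately show ?thesis
    using Lim_transform_eventually by fastforce
qed

text \<open>
  The source of the logarithm: the integral of \<open>tanh\<^sup>d\<close> up to \<open>x = arsinh (2 / t)\<close> differs from
  \<open>x\<close> by a convergent integral, and \<open>arsinh (2 / t) = ln (4 / t) + o(1)\<close>.
\<close>
lemma tendsto_radial_main_term:
  "((\<lambda>t. (LBINT r=0..2. r ^ d / sqrt (t\<^sup>2 + r\<^sup>2) ^ (d + 1)) - ln (1 / t))
    \<longlongrightarrow> 2 * ln 2 + (LBINT \<theta>=0..\<infinity>. tanh \<theta> ^ d - 1)) (at_right 0)"
proof -
  have "filterlim (\<lambda>t. arsinh (2 / t) :: real) at_top (at_right 0)"
    unfolding arsinh_real_def by real_asymp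
  then have "((\<lambda>t. (LBINT \<theta>=0..ereal (arsinh (2 / t)). tanh \<theta> ^ d) - arsinh (2 / t))
      \<longlongrightarrow> (LBINT \<theta>=0..\<infinity>. tanh \<theta> ^ d - 1)) (at_right 0)"
    by (rule filterlim_compose[OF tendsto_integral_tanh_power])
  moreover have "((\<lambda>t::real. arsinh (2 / t) - ln (1 / t)) \<longlongrightarrow> 2 * ln 2) (at_right 0)"
  proof -
    have "((\<lambda>t::real. arsinh (2 / t) - ln (1 / t)) \<longlongrightarrow> ln 4) (at_right 0)"
      unfolding arsinh_real_def by real_asymp
    moreover have "ln 4 = 2 * ln (2::real)"
      using ln_realpow[of 2 2] by simp
    ultimately show ?thesis by simp
  qed
  ultimately have "((\<lambda>t. (arsinh (2 / t) - ln (1 / t)) + ((LBINT \<theta>=0..ereal (arsinh (2 / t)). tanh \<theta> ^ d) - arsinh (2 / t)))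
      \<longlongrightarrow> 2 * ln 2 + (LBINT \<theta>=0..\<infinity>. tanh \<theta> ^ d - 1)) (at_right 0)"
    by (intro tendsto_add)
  then show ?thesis
  proof (rule Lim_transform_eventually, intro eventually_at_rightI[of 0 1])
    fix t :: real assume "t \<in> {0<..<1}"
    then have "t > 0" by simp
    from integral_power_div_sqrt_eq_tanh[OF this, of d]
    show "(arsinh (2 / t) - ln (1 / t)) + ((LBINT \<theta>=0..ereal (arsinh (2 / t)). tanh \<theta> ^ d) - arsinh (2 / t))
        = (LBINT r=0..2. r ^ d / sqrt (t\<^sup>2 + r\<^sup>2) ^ (d + 1)) - ln (1 / t)"
      by linarith
  qed simp
qed

text \<open>
  Dominated convergence.  Since \<open>r \<le> sqrt (t\<^sup>2 + r\<^sup>2)\<close>, the integrand is bounded for every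
  \<open>t > 0\<close> by \<open>|\<psi> r| / r\<^sup>2\<close>, which is its limit up to sign; the quadratic bound near \<open>0\<close> makes
  this integrable there, and the constant value beyond \<open>2\<close> makes it integrable at infinity.
\<close>
lemma tendsto_radial_remainder:
  fixes \<psi> :: "real \<Rightarrow> real"
  assumes [measurable]: "\<psi> \<in> borel_measurable borel"
    and d: "d \<ge> 1"
    and near: "\<And>r. 0 < r \<Longrightarrow> r < 2 \<Longrightarrow> \<bar>\<psi> r\<bar> \<le> K * r\<^sup>2"
    and far: "\<And>r. r \<ge> 2 \<Longrightarrow> \<psi> r = W"
  shows "((\<lambda>t. LBINT r:{0<..}. r ^ (d - 1) * \<psi> r / sqrt (t\<^sup>2 + r\<^sup>2) ^ (d + 1))
      \<longlongrightarrow> (LBINT r:{0<..}. \<psi> r / r\<^sup>2)) (at_right 0)"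
    and "\<And>t. t > 0 \<Longrightarrow> set_integrable lborel {0<..} (\<lambda>r. r ^ (d - 1) * \<psi> r / sqrt (t\<^sup>2 + r\<^sup>2) ^ (d + 1))"
    and "set_integrable lborel {0<..} (\<lambda>r. \<psi> r / r\<^sup>2)"
proof -
  define w where "w r = K * indicator {0..2} r + \<bar>W\<bar> * (indicator {2..} r *\<^sub>R (1 / r\<^sup>2))" for r :: real
  have K: "K \<ge> 0" using near[of 1] by auto
  have w: "integrable lborel w"
    unfolding w_def using set_integrable_inverse_square(1)
    by (intro Bochner_Integration.integrable_add integrable_mult_right)
      (auto simp: set_integrable_def)
  have bound: "\<bar>indicator {0<..} r * (\<psi> r / r\<^sup>2)\<bar> \<le> w r" for r
  proof -
    consider "r \<le> 0" | "0 < r" "r < 2" | "r \<ge> 2" by linarith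
    then show ?thesis
    proof cases
      case 1
      then show ?thesis using K by (simp add: w_def indicator_def)
    next
      case 2
      then have "\<bar>\<psi> r / r\<^sup>2\<bar> \<le> K" using near[of r] by (simp add: field_simps abs_divide)
      then show ?thesis using 2 by (simp add: w_def)
    next
      case 3
      then show ?thesis using K by (simp add: w_def far abs_divide)
    qed
  qed
  show h: "set_integrable lborel {0<..} (\<lambda>r. \<psi> r / r\<^sup>2)"
    unfolding set_integrable_def
  proof (rule Bochner_Integration.integrable_bound[OF w])
    show "AE r in lborel. norm (indicator {0<..} r *\<^sub>R (\<psi> r / r\<^sup>2)) \<le> norm (w r)"
      unfolding real_norm_def real_scaleR_def by (intro AE_I2 order_trans[OF bound abs_ge_self])
  qed measurable
  have dom: "\<bar>indicator {0<..} r * (r ^ (d - 1) * \<psi> r / sqrt (t\<^sup>2 + r\<^sup>2) ^ (d + 1))\<bar> \<le> w r"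
    if t: "t > 0" for t r
  proof (cases "r > 0")
    case True
    have s: "r \<le> sqrt (t\<^sup>2 + r\<^sup>2)" "0 < sqrt (t\<^sup>2 + r\<^sup>2)"
      using True t by (auto intro: real_le_rsqrt add_pos_pos)
    have "r ^ (d - 1) * r\<^sup>2 = r ^ (d + 1)"
      using d by (simp add: power_add[symmetric])
    also have "\<dots> \<le> sqrt (t\<^sup>2 + r\<^sup>2) ^ (d + 1)"
      using s True by (intro power_mono) auto
    finally have "r ^ (d - 1) / sqrt (t\<^sup>2 + r\<^sup>2) ^ (d + 1) \<le> 1 / r\<^sup>2"
      using True s by (simp add: field_simps)
    then have "\<bar>\<psi> r\<bar> * (r ^ (d - 1) / sqrt (t\<^sup>2 + r\<^sup>2) ^ (d + 1)) \<le> \<bar>\<psi> r\<bar> * (1 / r\<^sup>2)"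
      by (intro mult_left_mono) auto
    then show ?thesis
      using True s bound[of r] by (simp add: abs_mult abs_divide mult.commute)
  next
    case False
    then show ?thesis using bound[of r] by simp
  qed
  show int: "set_integrable lborel {0<..} (\<lambda>r. r ^ (d - 1) * \<psi> r / sqrt (t\<^sup>2 + r\<^sup>2) ^ (d + 1))" if "t > 0" for t
    unfolding set_integrable_def
  proof (rule Bochner_Integration.integrable_bound[OF w])
    show "AE r in lborel. norm (indicator {0<..} r *\<^sub>R (r ^ (d - 1) * \<psi> r / sqrt (t\<^sup>2 + r\<^sup>2) ^ (d + 1)))
        \<le> norm (w r)"
      unfolding real_norm_def real_scaleR_def by (intro AE_I2 order_trans[OF dom[OF that] abs_ge_self])
  qed measurable
  show "((\<lambda>t. LBINT r:{0<..}. r ^ (d - 1) * \<psi> r / sqrt (t\<^sup>2 + r\<^sup>2) ^ (d + 1))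
      \<longlongrightarrow> (LBINT r:{0<..}. \<psi> r / r\<^sup>2)) (at_right 0)"
    unfolding set_lebesgue_integral_def real_scaleR_def
  proof (rule integral_at_right_0_dominated_convergence[OF _ _ w])
    fix r :: real
    show "((\<lambda>t. indicator {0<..} r * (r ^ (d - 1) * \<psi> r / sqrt (t\<^sup>2 + r\<^sup>2) ^ (d + 1)))
        \<longlongrightarrow> indicator {0<..} r * (\<psi> r / r\<^sup>2)) (at_right 0)"
    proof (cases "r > 0")
      case True
      have "((\<lambda>t. r ^ (d - 1) * \<psi> r / sqrt (t\<^sup>2 + r\<^sup>2) ^ (d + 1))
          \<longlongrightarrow> r ^ (d - 1) * \<psi> r / sqrt (0\<^sup>2 + r\<^sup>2) ^ (d + 1)) (at_right 0)"
        using True by (intro tendsto_intros) auto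
      moreover have "r ^ (d - 1) * \<psi> r / sqrt (0\<^sup>2 + r\<^sup>2) ^ (d + 1) = \<psi> r / r\<^sup>2"
      proof -
        have "r ^ (d + 1) = r ^ (d - 1) * r\<^sup>2"
          using d by (simp add: power_add[symmetric])
        then show ?thesis using True by simp
      qed
      ultimately show ?thesis using True by simp
    qed simp
  qed (use dom in auto)
qed

text \<open>
  The one-dimensional form of the expansion, for any profile \<open>\<phi>\<close> that is linear up to a quadratic
  error at \<open>0\<close> and constant beyond \<open>2\<close>.  Subtracting the linear part on \<open>(0,2)\<close> leaves a
  function to which dominated convergence applies; the linear part alone produces the
  logarithm and the integral of \<open>tanh\<^sup>d - 1\<close>.
\<close>
lemma radial_asymptotics:
  fixes \<phi> :: "real \<Rightarrow> real"
  assumes [measurable]: "\<phi> \<in> borel_measurable borel"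
    and d: "d \<ge> 1"
    and near: "\<And>r. 0 < r \<Longrightarrow> r < 2 \<Longrightarrow> \<bar>\<phi> r - c * r\<bar> \<le> K * r\<^sup>2"
    and far: "\<And>r. r \<ge> 2 \<Longrightarrow> \<phi> r = W"
  shows "((\<lambda>t. (LBINT r:{0<..}. r ^ (d - 1) * \<phi> r / sqrt (t\<^sup>2 + r\<^sup>2) ^ (d + 1)) - c * ln (1 / t))
      \<longlongrightarrow> c * (2 * ln 2 + (LBINT \<theta>=0..\<infinity>. tanh \<theta> ^ d - 1))
         + (W / 2 - (LBINT s=0..1. inverse s * (c - \<phi> (2 * s) / (2 * s))))) (at_right 0)"
proof -
  define \<psi> where "\<psi> r = \<phi> r - c * r * indicator {..<2} r" for r
  have \<psi> [measurable]: "\<psi> \<in> borel_measurable borel"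
    unfolding \<psi>_def by measurable
  have near': "\<bar>\<psi> r\<bar> \<le> K * r\<^sup>2" if "0 < r" "r < 2" for r
    using near[OF that] that by (simp add: \<psi>_def)
  have far': "\<psi> r = W" if "r \<ge> 2" for r
    using far[OF that] that by (simp add: \<psi>_def)
  have rem: "((\<lambda>t. LBINT r:{0<..}. r ^ (d - 1) * \<psi> r / sqrt (t\<^sup>2 + r\<^sup>2) ^ (d + 1))
      \<longlongrightarrow> (LBINT r:{0<..}. \<psi> r / r\<^sup>2)) (at_right 0)"
    "set_integrable lborel {0<..} (\<lambda>r. r ^ (d - 1) * \<psi> r / sqrt (t\<^sup>2 + r\<^sup>2) ^ (d + 1))"
    "set_integrable lborel {0<..} (\<lambda>r. \<psi> r / r\<^sup>2)" if "t > 0" for t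
    using tendsto_radial_remainder[of \<psi> d K W] \<psi> d near' far' that by blast+
  let ?s = "\<lambda>t r. sqrt (t\<^sup>2 + r\<^sup>2) ^ (d + 1)"
  have split: "(LBINT r:{0<..}. r ^ (d - 1) * \<phi> r / ?s t r)
      = c * (LBINT r=0..2. r ^ d / ?s t r) + (LBINT r:{0<..}. r ^ (d - 1) * \<psi> r / ?s t r)"
    if t: "t > 0" for t
  proof -
    have "set_integrable lborel {0..2} (\<lambda>r. r ^ d / ?s t r)"
      using t by (intro borel_integrable_atLeastAtMost' continuous_intros) (auto simp: sum_power2_eq_zero_iff)
    then have i1: "set_integrable lborel {0<..<2} (\<lambda>r. r ^ d / ?s t r)"
      by (rule set_integrable_subset) auto
    have "(LBINT r:{0<..}. r ^ (d - 1) * \<phi> r / ?s t r)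
      = (\<integral>r. c * (indicator {0<..<2} r *\<^sub>R (r ^ d / ?s t r)) + indicator {0<..} r *\<^sub>R (r ^ (d - 1) * \<psi> r / ?s t r) \<partial>lborel)"
      unfolding set_lebesgue_integral_def
    proof (rule Bochner_Integration.integral_cong[OF refl])
      fix r :: real
      have "r ^ d = r ^ (d - 1) * r" using d by (cases d) auto
      then show "indicator {0<..} r *\<^sub>R (r ^ (d - 1) * \<phi> r / ?s t r)
        = c * (indicator {0<..<2} r *\<^sub>R (r ^ d / ?s t r)) + indicator {0<..} r *\<^sub>R (r ^ (d - 1) * \<psi> r / ?s t r)"
        by (simp add: \<psi>_def indicator_def add_divide_distrib[symmetric] algebra_simps)
    qed
    also have "\<dots> = c * (LBINT r:{0<..<2}. r ^ d / ?s t r) + (LBINT r:{0<..}. r ^ (d - 1) * \<psi> r / ?s t r)"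
      using i1 rem(2)[OF t] unfolding set_lebesgue_integral_def set_integrable_def
      by (simp only: Bochner_Integration.integral_add integral_mult_right_zero integrable_mult_right)
    also have "(LBINT r:{0<..<2}. r ^ d / ?s t r) = (LBINT r=0..2. r ^ d / ?s t r)"
      by (simp add: interval_integral_Ioo zero_ereal_def)
    finally show ?thesis .
  qed
  have "(LBINT r:{0<..}. \<psi> r / r\<^sup>2) = (LBINT r:{0<..<2}. \<psi> r / r\<^sup>2) + (LBINT r:{2..}. \<psi> r / r\<^sup>2)"
  proof -
    have U: "{0<..} = {0<..<2} \<union> {2::real..}" by auto
    have "set_integrable lborel {0<..<2} (\<lambda>r. \<psi> r / r\<^sup>2)" "set_integrable lborel {2..} (\<lambda>r. \<psi> r / r\<^sup>2)"
      by (rule set_integrable_subset[OF rem(3)[OF zero_less_one]]; auto)+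
    then show ?thesis
      unfolding U by (intro set_integral_Un) auto
  qed
  also have "(LBINT r:{2..}. \<psi> r / r\<^sup>2) = (LBINT r:{2..}. W * (1 / r\<^sup>2))"
    by (intro set_lebesgue_integral_cong) (auto simp: far')
  also have "\<dots> = W / 2"
    by (simp only: set_integral_mult_right set_integrable_inverse_square)
  also have "(LBINT r:{0<..<2}. \<psi> r / r\<^sup>2) = - (LBINT s=0..1. inverse s * (c - \<phi> (2 * s) / (2 * s)))"
  proof -
    \<comment> \<open>Substitute \<open>r = 2 s\<close>.\<close>
    have "(LBINT r:{0<..<2}. \<psi> r / r\<^sup>2)
        = 2 * (\<integral>s. indicator {0<..<2} (2 * s) *\<^sub>R (\<psi> (2 * s) / (2 * s)\<^sup>2) \<partial>lborel)"
      unfolding set_lebesgue_integral_def by (subst lborel_integral_real_affine[where c = 2 and t = 0]) auto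
    also have "\<dots> = (\<integral>s. - (indicator {0<..<1} s *\<^sub>R (inverse s * (c - \<phi> (2 * s) / (2 * s)))) \<partial>lborel)"
      unfolding integral_mult_right_zero[symmetric]
      by (intro Bochner_Integration.integral_cong)
        (auto simp: indicator_def \<psi>_def field_simps power2_eq_square)
    also have "\<dots> = - (LBINT s=0..1. inverse s * (c - \<phi> (2 * s) / (2 * s)))"
      by (simp add: interval_integral_Ioo zero_ereal_def one_ereal_def set_lebesgue_integral_def)
    finally show ?thesis .
  qed
  finally have lim_rem: "(LBINT r:{0<..}. \<psi> r / r\<^sup>2)
      = W / 2 - (LBINT s=0..1. inverse s * (c - \<phi> (2 * s) / (2 * s)))"
    by simp
  have "((\<lambda>t. c * ((LBINT r=0..2. r ^ d / ?s t r) - ln (1 / t)) + (LBINT r:{0<..}. r ^ (d - 1) * \<psi> r / ?s t r))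
      \<longlongrightarrow> c * (2 * ln 2 + (LBINT \<theta>=0..\<infinity>. tanh \<theta> ^ d - 1))
         + (W / 2 - (LBINT s=0..1. inverse s * (c - \<phi> (2 * s) / (2 * s))))) (at_right 0)"
    unfolding lim_rem[symmetric]
    by (intro tendsto_add tendsto_mult_left tendsto_radial_main_term rem(1)[OF zero_less_one])
  then show ?thesis
  proof (rule Lim_transform_eventually, intro eventually_at_rightI[of 0 1])
    fix t :: real assume "t \<in> {0<..<1}"
    then have "t > 0" by simp
    from split[OF this]
    show "c * ((LBINT r=0..2. r ^ d / ?s t r) - ln (1 / t)) + (LBINT r:{0<..}. r ^ (d - 1) * \<psi> r / ?s t r)
        = (LBINT r:{0<..}. r ^ (d - 1) * \<phi> r / ?s t r) - c * ln (1 / t)"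
      unfolding right_diff_distrib by linarith
  qed simp
qed

section \<open>Mass of the Poisson kernel\<close>

text \<open>
  The substitution \<open>u = r\<^sup>2 / (t\<^sup>2 + r\<^sup>2)\<close> turns twice the integrand into that of the Beta
  integral with parameters \<open>d / 2\<close> and \<open>1 / 2\<close>.  It is carried out on \<open>[0, n]\<close>, and monotone
  convergence gives the half-line.
\<close>
lemma nn_integral_poisson_radial:
  fixes t :: real
  assumes t: "t > 0" and d: "d \<ge> 2"
  shows "(\<integral>\<^sup>+r. ennreal (t * r ^ (d - 1) / sqrt (t\<^sup>2 + r\<^sup>2) ^ (d + 1)) * indicator {0..} r \<partial>lborel)
    = ennreal (Beta (real d / 2) (1 / 2) / 2)"
proof -
  define f where "f u = u powr (real d / 2 - 1) * (1 - u) powr (1 / 2 - 1)" for u :: real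
  define g where "g r = r\<^sup>2 / (t\<^sup>2 + r\<^sup>2)" for r
  define g' where "g' r = 2 * r * t\<^sup>2 / (t\<^sup>2 + r\<^sup>2)\<^sup>2" for r
  define h where "h r = t * r ^ (d - 1) / sqrt (t\<^sup>2 + r\<^sup>2) ^ (d + 1)" for r
  have pos: "t\<^sup>2 + r\<^sup>2 > 0" for r using t by (simp add: add_pos_nonneg)
  have [measurable]: "f \<in> borel_measurable borel" "h \<in> borel_measurable borel"
    unfolding f_def h_def by measurable
  have g0: "g 0 = 0" by (simp add: g_def)
  have g_less: "g r < 1" for r using t pos[of r] by (simp add: g_def)
  have g_alt: "g r = 1 - t\<^sup>2 / (t\<^sup>2 + r\<^sup>2)" for r
  proof -
    have "g r = ((t\<^sup>2 + r\<^sup>2) - t\<^sup>2) / (t\<^sup>2 + r\<^sup>2)" by (simp add: g_def)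
    then show ?thesis unfolding diff_divide_distrib using t by simp
  qed
  have g_mono: "g r \<le> g s" if "0 \<le> r" "r \<le> s" for r s
  proof -
    have "t\<^sup>2 + r\<^sup>2 \<le> t\<^sup>2 + s\<^sup>2" using that by (simp add: power_mono)
    then show ?thesis
      unfolding g_alt using pos[of r] by (intro diff_left_mono divide_left_mono) (auto intro: mult_pos_pos pos)
  qed
  have g_lim: "(\<lambda>n. g (real n)) \<longlonglongrightarrow> 1"
    unfolding g_def using t by real_asymp
  have sub: "(\<integral>\<^sup>+u. ennreal (f u) * indicator {0..g (real n)} u \<partial>lborel)
      = (\<integral>\<^sup>+r. ennreal (2 * h r) * indicator {0..real n} r \<partial>lborel)" for n
  proof -
    have fg: "f (g r) * g' r = 2 * h r" if r: "r \<ge> 0" for r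
    proof (cases "r = 0")
      case True
      then show ?thesis using d by (simp add: g'_def h_def power_0_left)
    next
      case False
      with r have r: "r > 0" by simp
      define s where "s = sqrt (t\<^sup>2 + r\<^sup>2)"
      have s: "s > 0" "s\<^sup>2 = t\<^sup>2 + r\<^sup>2" using pos[of r] by (auto simp: s_def)
      have gr: "g r = (r / s) powr 2" "1 - g r = (t / s) powr 2"
        using s r t by (simp_all add: g_def power_divide s(2)[symmetric] field_simps)
      have "f (g r) = ((r / s) powr 2) powr (real d / 2 - 1) * ((t / s) powr 2) powr (1 / 2 - 1)"
        unfolding f_def gr(2) unfolding gr(1) ..
      also have "\<dots> = (r / s) powr real (d - 2) * (t / s) powr (- 1)"
        unfolding powr_powr using d by (simp add: of_nat_diff algebra_simps)
      also have "\<dots> = (r / s) ^ (d - 2) * (s / t)"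
        using r s t by (simp add: powr_realpow powr_minus_divide)
      finally have "f (g r) * g' r = (r / s) ^ (d - 2) * (s / t) * (2 * r * t\<^sup>2 / (s\<^sup>2)\<^sup>2)"
        by (simp add: g'_def s(2))
      also have "\<dots> = 2 * (t * r ^ Suc (d - 2) / s ^ (d - 2 + 3))"
        using s(1) t by (simp add: power_divide power_add field_simps power2_eq_square power3_eq_cube)
      also have "\<dots> = 2 * h r"
      proof -
        have "Suc (d - 2) = d - 1" "d - 2 + 3 = d + 1" using d by auto
        then show ?thesis by (simp only: h_def s_def)
      qed
      finally show ?thesis .
    qed
    have "(\<integral>\<^sup>+u. f u * indicator {g 0..g (real n)} u \<partial>lborel)
        = (\<integral>\<^sup>+r. f (g r) * g' r * indicator {0..real n} r \<partial>lborel)"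
    proof (rule nn_integral_substitution)
      show "set_borel_measurable borel {g 0..g (real n)} f"
        unfolding set_borel_measurable_def by measurable
      show "(g has_real_derivative g' r) (at r)" for r
        unfolding g_def g'_def using pos[of r]
        by (auto intro!: derivative_eq_intros simp: field_simps power2_eq_square)
      show "continuous_on {0..real n} g'"
        unfolding g'_def using pos by (intro continuous_intros) (auto simp: less_imp_neq[symmetric])
      show "g' r \<ge> 0" if "r \<in> {0..real n}" for r
        using that by (simp add: g'_def)
    qed simp
    also have "\<dots> = (\<integral>\<^sup>+r. ennreal (2 * h r) * indicator {0..real n} r \<partial>lborel)"
      by (intro nn_integral_cong) (auto simp: fg indicator_def)
    also have "(\<integral>\<^sup>+u. f u * indicator {g 0..g (real n)} u \<partial>lborel)
        = (\<integral>\<^sup>+u. ennreal (f u) * indicator {0..g (real n)} u \<partial>lborel)"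
      by (intro nn_integral_cong) (auto simp: g0 indicator_def)
    finally show ?thesis .
  qed
  have "(\<lambda>n. \<integral>\<^sup>+u. ennreal (f u) * indicator {0..g (real n)} u \<partial>lborel)
      \<longlonglongrightarrow> (\<integral>\<^sup>+u. ennreal (f u) * indicator {0..<1} u \<partial>lborel)"
  proof (rule nn_integral_LIMSEQ)
    show "incseq (\<lambda>n u. ennreal (f u) * indicator {0..g (real n)} u)"
      by (auto simp: incseq_def le_fun_def indicator_def intro: order_trans[OF _ g_mono])
    show "(\<lambda>n. ennreal (f u) * indicator {0..g (real n)} u) \<longlonglongrightarrow> ennreal (f u) * indicator {0..<1} u" for u
    proof (rule tendsto_eventually)
      show "\<forall>\<^sub>F n in sequentially. ennreal (f u) * indicator {0..g (real n)} u = ennreal (f u) * indicator {0..<1} u"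
      proof (cases "u < 1")
        case True
        then have "\<forall>\<^sub>F n in sequentially. u < g (real n)"
          using g_lim by (simp add: order_tendsto_iff)
        then show ?thesis
          by eventually_elim (use True in \<open>auto simp: indicator_def\<close>)
      next
        case False
        then have "\<not> u \<le> g (real n)" for n using g_less[of "real n"] by linarith
        then show ?thesis using False by (simp add: indicator_def)
      qed
    qed
  qed measurable
  moreover have "(\<lambda>n. \<integral>\<^sup>+u. ennreal (f u) * indicator {0..g (real n)} u \<partial>lborel)
      \<longlonglongrightarrow> (\<integral>\<^sup>+r. ennreal (2 * h r) * indicator {0..} r \<partial>lborel)"
    unfolding sub
  proof (rule nn_integral_LIMSEQ)
    show "incseq (\<lambda>n r. ennreal (2 * h r) * indicator {0..real n} r)"
      by (auto simp: incseq_def le_fun_def indicator_def)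
    show "(\<lambda>n. ennreal (2 * h r) * indicator {0..real n} r) \<longlonglongrightarrow> ennreal (2 * h r) * indicator {0..} r" for r
    proof (rule tendsto_eventually)
      obtain N where "r \<le> real N" using real_arch_simple by blast
      then show "\<forall>\<^sub>F n in sequentially. ennreal (2 * h r) * indicator {0..real n} r = ennreal (2 * h r) * indicator {0..} r"
        by (intro eventually_sequentiallyI[of N]) (auto simp: indicator_def)
    qed
  qed measurable
  ultimately have eq: "(\<integral>\<^sup>+r. ennreal (2 * h r) * indicator {0..} r \<partial>lborel)
      = (\<integral>\<^sup>+u. ennreal (f u) * indicator {0..<1} u \<partial>lborel)"
    using LIMSEQ_unique by blast
  have hb: "h r \<ge> 0" if "r \<ge> 0" for r using that t by (simp add: h_def)
  have "2 * (\<integral>\<^sup>+r. ennreal (h r) * indicator {0..} r \<partial>lborel)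
      = (\<integral>\<^sup>+r. ennreal (2 * h r) * indicator {0..} r \<partial>lborel)"
    by (subst nn_integral_cmult[symmetric])
      (auto intro!: nn_integral_cong simp: indicator_def ennreal_mult' hb)
  also have "\<dots> = (\<integral>\<^sup>+u. ennreal (f u) * indicator {0..1} u \<partial>lborel)"
    unfolding eq
  proof (rule nn_integral_cong_AE)
    show "AE u in lborel. ennreal (f u) * indicator {0..<1} u = ennreal (f u) * indicator {0..1} u"
      using AE_lborel_singleton[of "1::real"] by eventually_elim (auto simp: indicator_def)
  qed
  also have "\<dots> = ennreal (Beta (real d / 2) (1 / 2))"
    unfolding f_def using d by (intro nn_integral_has_integral_lebesgue' has_integral_Beta_real) auto
  also have "\<dots> = 2 * ennreal (Beta (real d / 2) (1 / 2) / 2)"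
    by (subst ennreal_numeral[symmetric], subst ennreal_mult''[symmetric])
      (use d in \<open>auto simp: Beta_def intro!: divide_nonneg_pos mult_nonneg_nonneg less_imp_le Gamma_real_pos\<close>)
  finally have "(\<integral>\<^sup>+r. ennreal (h r) * indicator {0..} r \<partial>lborel) = ennreal (Beta (real d / 2) (1 / 2) / 2)"
    by (simp add: ennreal_mult_cancel_left)
  then show ?thesis unfolding h_def .
qed

lemma kappa_pos: "kappa d > 0"
  by (simp add: kappa_def Gamma_real_pos)

lemma poisson_kernel_eq:
  assumes "t > 0"
  shows "poisson_kernel t (x :: real ^ 'n) = kappa CARD('n) * t / sqrt (t\<^sup>2 + (norm x)\<^sup>2) ^ (CARD('n) + 1)"
proof -
  have "(real CARD('n) + 1) / 2 = real (CARD('n) + 1) / 2" by simp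
  then show ?thesis
    using sqrt_sum_squares_power[OF assms, of "norm x" "CARD('n) + 1"]
    by (simp only: poisson_kernel_def)
qed

lemma kappa_mass:
  assumes "d \<ge> 1"
  shows "kappa d * (real d * unit_ball_vol (real d)) * (Beta (real d / 2) (1 / 2) / 2) = 1"
proof -
  have G: "Gamma (real d / 2) > 0" "Gamma ((1 + real d) / 2) > 0" "Gamma ((real d + 2) / 2) > 0"
    using assms by (auto intro!: Gamma_real_pos)
  then have nz: "Gamma (real d / 2) \<noteq> 0" "Gamma ((1 + real d) / 2) \<noteq> 0" "Gamma ((real d + 2) / 2) \<noteq> 0"
    by linarith+
  have "Gamma (real d / 2 + 1) = real d / 2 * Gamma (real d / 2)"
    using assms by (intro Gamma_plus1) auto
  moreover have "pi powr (- ((real d + 1) / 2)) * pi powr (real d / 2) * sqrt pi = 1"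
    by (simp add: powr_half_sqrt[symmetric] powr_add[symmetric] field_simps)
  moreover have "(real d + 1) / 2 = real d / 2 + 1 / 2" by simp
  ultimately show ?thesis
    using G nz assms by (simp add: kappa_def unit_ball_vol_def Beta_def Gamma_one_half_real field_simps nz)
qed

text \<open>
  This identity is the reason for the factor \<open>1 / \<pi>\<close> in front of the logarithm.
\<close>
lemma kappa_unit_ball_vol:
  assumes "d \<ge> 1"
  shows "kappa d * unit_ball_vol (real (d - 1)) = 1 / pi"
proof -
  have e: "real (d - 1) / 2 + 1 = (real d + 1) / 2" using assms by (simp add: of_nat_diff field_simps)
  have "Gamma ((1 + real d) / 2) > 0" by (intro Gamma_real_pos) simp
  then have "Gamma ((1 + real d) / 2) \<noteq> 0" by linarith
  moreover have "pi powr (- ((real d + 1) / 2)) * pi powr (real (d - 1) / 2) = pi powr (- 1)"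
    unfolding powr_add[symmetric] using assms by (simp add: of_nat_diff field_simps)
  ultimately show ?thesis
    unfolding kappa_def unit_ball_vol_def e
    by (simp add: powr_minus_divide field_simps)
qed

lemma borel_measurable_poisson_kernel [measurable]:
  "(poisson_kernel t :: real ^ 'n \<Rightarrow> real) \<in> borel_measurable borel"
  unfolding poisson_kernel_def by measurable

lemma nn_integral_poisson_kernel:
  assumes t: "t > 0" and d: "CARD('n) \<ge> 2"
  shows "(\<integral>\<^sup>+x. ennreal (poisson_kernel t (x :: real ^ 'n)) \<partial>lborel) = 1"
proof -
  let ?d = "CARD('n)"
  let ?c = "kappa ?d * (real ?d * unit_ball_vol (real ?d))"
  have c: "?c \<ge> 0" using kappa_pos[of ?d] by simp
  have "(\<integral>\<^sup>+x. ennreal (poisson_kernel t (x :: real ^ 'n)) \<partial>lborel)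
      = (\<integral>\<^sup>+x. ennreal (kappa ?d * t / sqrt (t\<^sup>2 + (norm (x :: real ^ 'n))\<^sup>2) ^ (?d + 1)) \<partial>lborel)"
    by (simp only: poisson_kernel_eq[OF t])
  also have "\<dots> = (\<integral>\<^sup>+r. ennreal (kappa ?d * t / sqrt (t\<^sup>2 + r\<^sup>2) ^ (?d + 1))
      * (ennreal (real ?d * unit_ball_vol (real ?d) * r ^ (?d - 1)) * indicator {0..} r) \<partial>lborel)"
    by (subst nn_integral_norm_lborel[where 'a = "real ^ 'n"]) simp_all
  also have "\<dots> = (\<integral>\<^sup>+r. ennreal ?c * (ennreal (t * r ^ (?d - 1) / sqrt (t\<^sup>2 + r\<^sup>2) ^ (?d + 1)) * indicator {0..} r) \<partial>lborel)"
  proof (intro nn_integral_cong)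
    fix r :: real
    show "ennreal (kappa ?d * t / sqrt (t\<^sup>2 + r\<^sup>2) ^ (?d + 1))
        * (ennreal (real ?d * unit_ball_vol (real ?d) * r ^ (?d - 1)) * indicator {0..} r)
      = ennreal ?c * (ennreal (t * r ^ (?d - 1) / sqrt (t\<^sup>2 + r\<^sup>2) ^ (?d + 1)) * indicator {0..} r)"
      using t c kappa_pos[of ?d]
      by (cases "r \<ge> 0") (simp_all add: ennreal_mult[symmetric] mult_ac)
  qed
  also have "\<dots> = ennreal ?c * ennreal (Beta (real ?d / 2) (1 / 2) / 2)"
    using nn_integral_poisson_radial[OF t d] by (subst nn_integral_cmult) auto
  also have "\<dots> = ennreal 1"
    using kappa_mass[of ?d] d c by (subst ennreal_mult'[symmetric]) auto
  finally show ?thesis by simp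
qed

section \<open>The heat loss as a radial integral\<close>

text \<open>
  The orthogonal group acts transitively on spheres.
\<close>
lemma set_covariance_norm:
  fixes z :: "real ^ 'n"
  shows "set_covariance (ball 0 1) z = set_covariance (ball 0 1) (norm z *\<^sub>R (axis k 1 :: real ^ 'n))"
proof -
  obtain f where f: "orthogonal_transformation f" "f z = norm z *\<^sub>R (axis k 1 :: real ^ 'n)"
    using orthogonal_transformation_exists[of z "norm z *\<^sub>R (axis k 1 :: real ^ 'n)"] by auto
  show ?thesis
    using set_covariance_orthogonal[OF f(1), of 1 z] f(2) by simp
qed

lemma set_covariance_eq_slab:
  fixes z :: "real ^ 'n"
  shows "set_covariance (ball 0 1) z = measure lborel (ball (0 :: real ^ 'n) 1) - measure lborel (slab (axis k 1 :: real ^ 'n) (norm z))"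
  using ball_covariance_drop_eq_slab[of "axis k 1 :: real ^ 'n" "norm z"]
  by (subst set_covariance_norm[of z k]) (simp add: set_covariance_zero)

lemma borel_measurable_measure_slab [measurable]: "(\<lambda>r. measure lborel (slab b r)) \<in> borel_measurable borel"
  by (rule borel_measurable_mono[OF mono_measure_slab])

text \<open>
  With \<open>g\<close> the covariance of the ball, Tonelli's theorem gives
  \<open>H(t) = \<integral> p\<^sub>t(z) g(z) dz\<close>, and \<open>|B| = \<integral> p\<^sub>t(z) |B| dz\<close> because the kernel has mass one.
  The difference is the integral of \<open>p\<^sub>t(z) (|B| - g(z))\<close>, and \<open>|B| - g(z)\<close> is the volume of
  a slab of width \<open>|z|\<close>.  The computation is made with extended nonnegative integrals, to which
  Tonelli's theorem applies directly; only its end result is a real number.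
\<close>
lemma heat_loss_eq:
  fixes k :: "'n::finite"
  assumes t: "t > 0" and d: "CARD('n) \<ge> 2"
  defines "\<phi> \<equiv> \<lambda>r. measure lborel (slab (axis k 1 :: real ^ 'n) r)"
  shows "measure lborel (ball (0 :: real ^ 'n) 1) - heat_content (ball (0 :: real ^ 'n) 1) t
    = enn2real (\<integral>\<^sup>+z. ennreal (poisson_kernel t (z :: real ^ 'n) * \<phi> (norm z)) \<partial>lborel)"
proof -
  let ?B = "ball (0 :: real ^ 'n) 1"
  let ?p = "poisson_kernel t :: real ^ 'n \<Rightarrow> real"
  let ?w = "measure lborel ?B"
  have p0: "?p x \<ge> 0" for x
    using t kappa_pos[of "CARD('n)"] by (simp add: poisson_kernel_eq)
  have [measurable]: "?B \<in> sets borel" by simp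
  define I where "I x = (\<integral>\<^sup>+z. ennreal (?p z) * indicator ?B (x - z) \<partial>lborel)" for x
  have I_eq: "(\<integral>\<^sup>+y. ennreal (indicator ?B y *\<^sub>R ?p (x - y)) \<partial>lborel) = I x" for x
  proof -
    have "distr lborel borel (\<lambda>z. x - z) = (lborel :: (real ^ 'n) measure)"
      using lborel_affine[of "-1" x] by (simp add: density_1)
    then have "(\<integral>\<^sup>+y. ennreal (indicator ?B y *\<^sub>R ?p (x - y)) \<partial>lborel)
        = (\<integral>\<^sup>+y. ennreal (indicator ?B y *\<^sub>R ?p (x - y)) \<partial>distr lborel borel (\<lambda>z. x - z))"
      by simp
    also have "\<dots> = I x"
      unfolding I_def by (subst nn_integral_distr) (auto intro!: nn_integral_cong simp: indicator_def)
    finally show ?thesis .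
  qed
  have I_le: "I x \<le> 1" for x
  proof -
    have "I x \<le> (\<integral>\<^sup>+z. ennreal (?p z) \<partial>lborel)"
      unfolding I_def by (intro nn_integral_mono) (auto simp: indicator_def)
    then show ?thesis by (simp add: nn_integral_poisson_kernel[OF t d])
  qed
  have [measurable]: "I \<in> borel_measurable borel"
    unfolding I_def by measurable
  have inner: "(LBINT y:?B. ?p (x - y)) = enn2real (I x)" for x
    unfolding set_lebesgue_integral_def I_eq[symmetric]
    by (rule integral_eq_nn_integral) (auto simp: p0)
  have "heat_content ?B t = enn2real (\<integral>\<^sup>+x. ennreal (indicator ?B x *\<^sub>R enn2real (I x)) \<partial>lborel)"
    unfolding heat_content_def inner
    unfolding set_lebesgue_integral_def by (rule integral_eq_nn_integral) auto
  also have "(\<integral>\<^sup>+x. ennreal (indicator ?B x *\<^sub>R enn2real (I x)) \<partial>lborel)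
      = (\<integral>\<^sup>+x. indicator ?B x * I x \<partial>lborel)"
  proof (intro nn_integral_cong)
    fix x
    have "I x < top" using I_le[of x] by (rule le_less_trans) simp
    then show "ennreal (indicator ?B x *\<^sub>R enn2real (I x)) = indicator ?B x * I x"
      by (auto simp: indicator_def)
  qed
  also have "\<dots> = (\<integral>\<^sup>+x. \<integral>\<^sup>+z. indicator ?B x * (ennreal (?p z) * indicator ?B (x - z)) \<partial>lborel \<partial>lborel)"
    unfolding I_def by (intro nn_integral_cong, subst nn_integral_cmult) auto
  also have "\<dots> = (\<integral>\<^sup>+z. \<integral>\<^sup>+x. indicator ?B x * (ennreal (?p z) * indicator ?B (x - z)) \<partial>lborel \<partial>lborel)"
    by (rule lborel_pair.Fubini'[symmetric]) measurable
  also have "\<dots> = (\<integral>\<^sup>+z. ennreal (?p z * (?w - \<phi> (norm z))) \<partial>lborel)"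
  proof (intro nn_integral_cong)
    fix z :: "real ^ 'n"
    have tr: "(\<lambda>x. x + z) ` ?B = ball z 1"
      by (rule set_eqI) (simp add: mem_translation_iff dist_norm norm_minus_commute)
    have "(\<integral>\<^sup>+x. indicator ?B x * (ennreal (?p z) * indicator ?B (x - z)) \<partial>lborel)
        = (\<integral>\<^sup>+x. ennreal (?p z) * indicator (?B \<inter> ball z 1) x \<partial>lborel)"
      by (intro nn_integral_cong) (auto simp: indicator_def dist_norm norm_minus_commute)
    also have "\<dots> = ennreal (?p z) * emeasure lborel (?B \<inter> ball z 1)"
      by (rule nn_integral_cmult_indicator) simp
    also have "emeasure lborel (?B \<inter> ball z 1) = ennreal (measure lborel (?B \<inter> ball z 1))"
    proof (rule emeasure_eq_ennreal_measure)
      have "emeasure lborel (?B \<inter> ball z 1) \<le> emeasure lborel ?B"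
        by (intro emeasure_mono) auto
      also have "\<dots> < \<infinity>" by (rule emeasure_lborel_ball_finite)
      finally show "emeasure lborel (?B \<inter> ball z 1) \<noteq> top" by auto
    qed
    also have "measure lborel (?B \<inter> ball z 1) = ?w - \<phi> (norm z)"
      using set_covariance_eq_slab[of z k] by (simp add: set_covariance_def tr \<phi>_def)
    finally show "(\<integral>\<^sup>+x. indicator ?B x * (ennreal (?p z) * indicator ?B (x - z)) \<partial>lborel)
        = ennreal (?p z * (?w - \<phi> (norm z)))"
      by (simp add: ennreal_mult' p0)
  qed
  finally have H: "heat_content ?B t = enn2real (\<integral>\<^sup>+z. ennreal (?p z * (?w - \<phi> (norm z))) \<partial>lborel)" .
  have \<phi>m [measurable]: "\<phi> \<in> borel_measurable borel"
    unfolding \<phi>_def by measurable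
  have \<phi>0: "\<phi> r \<ge> 0" for r by (simp add: \<phi>_def)
  have \<phi>w: "\<phi> (norm z) \<le> ?w" for z :: "real ^ 'n"
    using set_covariance_eq_slab[of z k] measure_nonneg[of lborel "?B \<inter> (\<lambda>x. x + z) ` ?B"]
    by (simp add: set_covariance_def \<phi>_def)
  have "(\<integral>\<^sup>+z. ennreal (?p z * (?w - \<phi> (norm z))) \<partial>lborel) + (\<integral>\<^sup>+z. ennreal (?p z * \<phi> (norm z)) \<partial>lborel)
      = (\<integral>\<^sup>+z. ennreal (?p z * (?w - \<phi> (norm z))) + ennreal (?p z * \<phi> (norm z)) \<partial>lborel)"
    by (rule nn_integral_add[symmetric]) measurable
  also have "\<dots> = (\<integral>\<^sup>+z. ennreal ?w * ennreal (?p z) \<partial>lborel)"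
  proof (intro nn_integral_cong)
    fix z :: "real ^ 'n"
    have "ennreal (?p z * (?w - \<phi> (norm z))) + ennreal (?p z * \<phi> (norm z))
        = ennreal (?p z * (?w - \<phi> (norm z)) + ?p z * \<phi> (norm z))"
      using p0 \<phi>0 \<phi>w by (intro ennreal_plus[symmetric] mult_nonneg_nonneg) (auto simp: le_diff_eq)
    also have "?p z * (?w - \<phi> (norm z)) + ?p z * \<phi> (norm z) = ?w * ?p z"
      by (simp add: algebra_simps)
    also have "ennreal (?w * ?p z) = ennreal ?w * ennreal (?p z)"
      by (rule ennreal_mult) (auto simp: p0)
    finally show "ennreal (?p z * (?w - \<phi> (norm z))) + ennreal (?p z * \<phi> (norm z)) = ennreal ?w * ennreal (?p z)" .
  qed
  also have "\<dots> = ennreal ?w"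
    by (subst nn_integral_cmult) (auto simp: nn_integral_poisson_kernel[OF t d])
  finally have sum: "(\<integral>\<^sup>+z. ennreal (?p z * (?w - \<phi> (norm z))) \<partial>lborel)
      + (\<integral>\<^sup>+z. ennreal (?p z * \<phi> (norm z)) \<partial>lborel) = ennreal ?w" .
  have "(\<integral>\<^sup>+z. ennreal (?p z * (?w - \<phi> (norm z))) \<partial>lborel)
      + (\<integral>\<^sup>+z. ennreal (?p z * \<phi> (norm z)) \<partial>lborel) < top"
    unfolding sum by (rule ennreal_less_top)
  then have fin: "(\<integral>\<^sup>+z. ennreal (?p z * (?w - \<phi> (norm z))) \<partial>lborel) < top"
      "(\<integral>\<^sup>+z. ennreal (?p z * \<phi> (norm z)) \<partial>lborel) < top"
    by simp_all
  have "enn2real (\<integral>\<^sup>+z. ennreal (?p z * (?w - \<phi> (norm z))) \<partial>lborel)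
      + enn2real (\<integral>\<^sup>+z. ennreal (?p z * \<phi> (norm z)) \<partial>lborel) = ?w"
    using sum by (simp add: enn2real_plus[symmetric, OF fin])
  then show ?thesis using H by linarith
qed

text \<open>
  The integrand of \<open>heat_loss_eq\<close> is radial, so polar coordinates apply.  The half-line is taken
  without the null set \<open>{0}\<close> because the asymptotic analysis divides by powers of \<open>r\<close>.
\<close>
lemma heat_loss_radial:
  fixes k :: "'n::finite"
  assumes t: "t > 0" and d: "CARD('n) \<ge> 2"
  defines "\<phi> \<equiv> \<lambda>r. measure lborel (slab (axis k 1 :: real ^ 'n) r)"
  shows "measure lborel (ball (0 :: real ^ 'n) 1) - heat_content (ball (0 :: real ^ 'n) 1) t
    = kappa CARD('n) * (real CARD('n) * unit_ball_vol (real CARD('n))) * t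
      * (LBINT r:{0<..}. r ^ (CARD('n) - 1) * \<phi> r / sqrt (t\<^sup>2 + r\<^sup>2) ^ (CARD('n) + 1))"
proof -
  let ?d = "CARD('n)"
  let ?c = "kappa ?d * (real ?d * unit_ball_vol (real ?d)) * t"
  have c: "?c \<ge> 0" using kappa_pos[of ?d] t by simp
  have \<phi>m [measurable]: "\<phi> \<in> borel_measurable borel"
    unfolding \<phi>_def by measurable
  have \<phi>0: "\<phi> r \<ge> 0" for r by (simp add: \<phi>_def)
  have "(\<integral>\<^sup>+z. ennreal (poisson_kernel t (z :: real ^ 'n) * \<phi> (norm z)) \<partial>lborel)
      = (\<integral>\<^sup>+z. ennreal (kappa ?d * t / sqrt (t\<^sup>2 + (norm (z :: real ^ 'n))\<^sup>2) ^ (?d + 1) * \<phi> (norm z)) \<partial>lborel)"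
    by (simp only: poisson_kernel_eq[OF t])
  also have "\<dots> = (\<integral>\<^sup>+r. ennreal (kappa ?d * t / sqrt (t\<^sup>2 + r\<^sup>2) ^ (?d + 1) * \<phi> r)
      * (ennreal (real ?d * unit_ball_vol (real ?d) * r ^ (?d - 1)) * indicator {0..} r) \<partial>lborel)"
    by (subst nn_integral_norm_lborel[where 'a = "real ^ 'n"]) simp_all
  also have "\<dots> = (\<integral>\<^sup>+r. ennreal (?c * (indicator {0<..} r *\<^sub>R (r ^ (?d - 1) * \<phi> r / sqrt (t\<^sup>2 + r\<^sup>2) ^ (?d + 1)))) \<partial>lborel)"
  proof (rule nn_integral_cong_AE)
    show "AE r in lborel. ennreal (kappa ?d * t / sqrt (t\<^sup>2 + r\<^sup>2) ^ (?d + 1) * \<phi> r)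
        * (ennreal (real ?d * unit_ball_vol (real ?d) * r ^ (?d - 1)) * indicator {0..} r)
      = ennreal (?c * (indicator {0<..} r *\<^sub>R (r ^ (?d - 1) * \<phi> r / sqrt (t\<^sup>2 + r\<^sup>2) ^ (?d + 1))))"
      using AE_lborel_singleton[of "0::real"]
    proof eventually_elim
      case (elim r)
      show ?case
      proof (cases "r > 0")
        case True
        then show ?thesis
          using t kappa_pos[of ?d] \<phi>0[of r] by (simp add: ennreal_mult[symmetric] mult_ac)
      next
        case False
        with elim show ?thesis by simp
      qed
    qed
  qed
  finally have eq: "(\<integral>\<^sup>+z. ennreal (poisson_kernel t (z :: real ^ 'n) * \<phi> (norm z)) \<partial>lborel)
    = (\<integral>\<^sup>+r. ennreal (?c * (indicator {0<..} r *\<^sub>R (r ^ (?d - 1) * \<phi> r / sqrt (t\<^sup>2 + r\<^sup>2) ^ (?d + 1)))) \<partial>lborel)" .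
  have "enn2real \<dots> = (\<integral>r. ?c * (indicator {0<..} r *\<^sub>R (r ^ (?d - 1) * \<phi> r / sqrt (t\<^sup>2 + r\<^sup>2) ^ (?d + 1))) \<partial>lborel)"
  proof (rule integral_eq_nn_integral[symmetric])
    show "AE r in lborel. 0 \<le> ?c * (indicator {0<..} r *\<^sub>R (r ^ (?d - 1) * \<phi> r / sqrt (t\<^sup>2 + r\<^sup>2) ^ (?d + 1)))"
      by (intro AE_I2 mult_nonneg_nonneg[OF c]) (auto simp: indicator_def \<phi>0)
  qed measurable
  also have "\<dots> = ?c * (LBINT r:{0<..}. r ^ (?d - 1) * \<phi> r / sqrt (t\<^sup>2 + r\<^sup>2) ^ (?d + 1))"
    unfolding set_lebesgue_integral_def by (rule integral_mult_right_zero)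
  finally show ?thesis
    using heat_loss_eq[OF t d, of k] by (simp only: \<phi>_def eq[unfolded \<phi>_def])
qed

section \<open>Small-time expansion of the heat content\<close>

theorem theorem1p1:
  fixes B :: "(real ^ 'n) set" and S :: "(real ^ 'n) set" and k :: 'n
  assumes "CARD('n) \<ge> 2"
    and "B = ball 0 1"
    and "S = sphere 0 1"
  shows "((\<lambda>t. 1 / t * (measure lborel B - heat_content B t
                         - surface_area S / pi * t * ln (1 / t)))
          \<longlongrightarrow>
          surface_area S *
            (kappa CARD('n) *
               (measure lborel B / 2
                 - (LBINT s=0..1. inverse s * gamma_ball (axis k 1 :: real ^ 'n) (2 * s)))
             + 1 / pi * (2 * ln 2 + (LBINT \<theta>=0..\<infinity>. (tanh \<theta> ^ CARD('n) - 1)))))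
         (at_right 0)"
proof -
  let ?d = "CARD('n)"
  let ?e = "axis k 1 :: real ^ 'n"
  define A where "A = surface_area S"
  define \<kappa> where "\<kappa> = kappa ?d"
  define c where "c = unit_ball_vol (real (?d - 1))"
  define W where "W = measure lborel B"
  define \<phi> where "\<phi> r = measure lborel (slab ?e r)" for r
  define J where "J t = (LBINT r:{0<..}. r ^ (?d - 1) * \<phi> r / sqrt (t\<^sup>2 + r\<^sup>2) ^ (?d + 1))" for t
  define T where "T = (LBINT \<theta>=0..\<infinity>. (tanh \<theta> ^ ?d - (1::real)))"
  define G where "G = (LBINT s=0..1. inverse s * gamma_ball ?e (2 * s))"
  have e: "?e \<in> Basis" "norm ?e = 1" by (simp_all add: axis_in_Basis_iff)
  have A: "A = real ?d * unit_ball_vol (real ?d)"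
    unfolding A_def assms(3) by (simp add: surface_area_unit_sphere)
  have \<kappa>c: "\<kappa> * c = 1 / pi"
    unfolding \<kappa>_def c_def using assms(1) by (intro kappa_unit_ball_vol) simp
  have c: "c \<ge> 0" by (simp add: c_def)
  have G_eq: "G = (LBINT s=0..1. inverse s * (c - \<phi> (2 * s) / (2 * s)))"
    unfolding G_def
  proof (rule interval_integral_cong)
    fix s :: real assume "s \<in> einterval (min 0 1) (max 0 1)"
    then have s: "s > 0" by (simp add: einterval_def)
    show "inverse s * gamma_ball ?e (2 * s) = inverse s * (c - \<phi> (2 * s) / (2 * s))"
      using ball_covariance_drop_eq_slab[of ?e "2 * s"] e s
      by (simp add: gamma_ball_def c_def \<phi>_def)
  qed
  \<comment> \<open>The constant \<open>c (d - 1) / 2\<close> comes from the cubic error \<open>c (d - 1) r\<^sup>3 / 4\<close> of the slab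
    volume and \<open>r < 2\<close>.\<close>
  have "((\<lambda>t. J t - c * ln (1 / t)) \<longlongrightarrow> c * (2 * ln 2 + T) + (W / 2 - G)) (at_right 0)"
    unfolding J_def T_def G_eq
  proof (rule radial_asymptotics)
    show "\<phi> \<in> borel_measurable borel" unfolding \<phi>_def by measurable
    show "\<phi> r = W" if "r \<ge> 2" for r
      using that e by (simp add: \<phi>_def W_def assms(2) slab_eq_ball)
    show "\<bar>\<phi> r - c * r\<bar> \<le> c * (real ?d - 1) / 2 * r\<^sup>2" if r: "0 < r" "r < 2" for r
    proof -
      have up: "\<phi> r \<le> c * r"
        using measure_slab_le[OF e(1), of r] r by (simp add: \<phi>_def c_def mult.commute)
      have lo: "r * c * (1 - (real ?d - 1) * (r\<^sup>2 / 4)) \<le> \<phi> r"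
        using measure_slab_ge[OF e(1) r] by (simp add: \<phi>_def c_def)
      have "c * r - \<phi> r \<le> c * (real ?d - 1) * r\<^sup>2 / 4 * r"
      proof -
        have "r * c * (1 - (real ?d - 1) * (r\<^sup>2 / 4)) = c * r - c * (real ?d - 1) * r\<^sup>2 / 4 * r"
          by (simp add: field_simps)
        with lo show ?thesis by linarith
      qed
      also have "\<dots> \<le> c * (real ?d - 1) * r\<^sup>2 / 4 * 2"
        using r c assms(1) by (intro mult_left_mono) auto
      finally show ?thesis using up by simp
    qed
  qed (use assms(1) in simp)
  then have "((\<lambda>t. A * \<kappa> * (J t - c * ln (1 / t))) \<longlongrightarrow> A * \<kappa> * (c * (2 * ln 2 + T) + (W / 2 - G))) (at_right 0)"
    by (rule tendsto_mult_left)
  moreover have "A * \<kappa> * (c * (2 * ln 2 + T) + (W / 2 - G)) = A * (\<kappa> * (W / 2 - G) + 1 / pi * (2 * ln 2 + T))"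
    unfolding \<kappa>c[symmetric] by (simp add: algebra_simps)
  moreover have "\<forall>\<^sub>F t in at_right 0. A * \<kappa> * (J t - c * ln (1 / t))
      = 1 / t * (measure lborel B - heat_content B t - A / pi * t * ln (1 / t))"
  proof (rule eventually_at_rightI[of 0 1])
    fix t :: real assume "t \<in> {0<..<1}"
    then have t: "t > 0" by simp
    have "measure lborel B - heat_content B t = \<kappa> * A * t * J t"
      unfolding assms(2) A \<kappa>_def J_def \<phi>_def using heat_loss_radial[OF t assms(1), of k] .
    moreover have "A / pi = A * \<kappa> * c"
      using \<kappa>c by (simp add: mult.assoc)
    moreover have "A * \<kappa> * (J t - c * ln (1 / t)) = 1 / t * (\<kappa> * A * t * J t - A * \<kappa> * c * t * ln (1 / t))"
      using t by (simp add: field_simps)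
    ultimately show "A * \<kappa> * (J t - c * ln (1 / t))
      = 1 / t * (measure lborel B - heat_content B t - A / pi * t * ln (1 / t))"
      by (simp only:)
  qed simp
  ultimately show ?thesis
    unfolding A_def \<kappa>_def W_def G_def T_def
    by (auto intro: Lim_transform_eventually)
qed

end
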